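(* Let $p\geq 37$ be prime and let $c\in\mathcal C(2,p)$ with $\mathrm{wt}(c)\leq 4p+3$ if $p\leq 47$, and $\mathrm{wt}(c)\leq 5p-36$ if $p\geq 53$. Then either (1) $c$ is a linear combination of (the characteristic functions of) at most 4 lines, (2) $c$ is a linear combination of an odd codeword on 3 lines and (the characteristic function of) another line, or (3) $c$ is an odd codeword on 4 lines.
   Context: $\mathrm{PG}(2,p)$ is the Desarguesian projective plane over $\mathbb F_p$, with point set $\mathcal P$. For a line $\ell$, $\chi_\ell:\mathcal P\to\mathbb F_p$ is $1$ on points of $\ell$ and $0$ elsewhere. $\mathcal C(2,p)$ is the $\mathbb F_p$-span of all $\chi_\ell$. The weight $\mathrm{wt}(c)$ is the number of points $P$ with $c(P)\neq 0$ (the support $\mathrm{supp}(c)$). A codeword $c\in\mathcal C(2,p)$ is an odd codeword on $n$ lines if there are $n$ lines $\ell_1,\dots,\ell_n$ through a common point $P$ whose union contains $\mathrm{supp}(c)$, and for none of the $\ell_i$ is $c$ constant on $\ell_i\setminus\{P\}$. *)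

theory Defs
  imports "HOL-Analysis.Analysis"
begin

text \<open>The points of \<open>PG(2,q)\<close> are the one-dimensional subspaces of \<open>F\<^sup>3\<close>, where \<open>F\<close> is the field with
  \<open>q\<close> elements. They form a type of their own, so that a word of the code is a vector indexed by points.\<close>

lemma ex_one_dim_subspace: "\<exists>U :: ('a::field ^ 3) set. vec.subspace U \<and> vec.dim U = 1"
proof -
  have "vec.independent {axis 1 1 :: 'a ^ 3}"
    by (simp add: vec.dependent_single)
  then have "vec.dim (vec.span {axis 1 1 :: 'a ^ 3}) = 1"
    using vec.dim_span_eq_card_independent by fastforce
  then show ?thesis
    using vec.subspace_span by blast
qed

typedef (overloaded) 'a point = "{U :: ('a::field ^ 3) set. vec.subspace U \<and> vec.dim U = 1}"
  morphisms point_subspace Abs_point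
  using ex_one_dim_subspace by simp

instance point :: ("{field, finite}") finite
proof
  have "finite (range (point_subspace :: 'a point \<Rightarrow> ('a ^ 3) set))"
    by simp
  then show "finite (UNIV :: 'a point set)"
    using finite_imageD point_subspace_inject by (metis inj_onI)
qed

definition plane_lines :: "'a::field point set set" where
  "plane_lines =
     {{P. point_subspace P \<subseteq> W} | W :: ('a ^ 3) set. vec.subspace W \<and> vec.dim W = 2}"

definition char_vec :: "'a point set \<Rightarrow> 'a::{field, finite} ^ 'a point" where
  "char_vec l = (\<chi> P. if P \<in> l then 1 else 0)"

definition plane_code :: "('a::{field, finite} ^ 'a point) set" where
  "plane_code = vec.span (char_vec ` plane_lines)"

definition supp :: "'a::{field, finite} ^ 'a point \<Rightarrow> 'a point set" where
  "supp c = {P. c $ P \<noteq> 0}"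

definition wt :: "'a::{field, finite} ^ 'a point \<Rightarrow> nat" where
  "wt c = card (supp c)"

text \<open>\<open>L\<close> is the set of the lines carrying the odd codeword \<open>c\<close>, and \<open>P\<close> their common point. The lines
  are pairwise distinct, so an odd codeword on \<open>n\<close> lines is one with \<open>card L = n\<close>.\<close>

definition odd_codeword_with ::
    "'a::{field, finite} point \<Rightarrow> 'a point set set \<Rightarrow> 'a ^ 'a point \<Rightarrow> bool" where
  "odd_codeword_with P L c \<longleftrightarrow>
     c \<in> plane_code \<and> L \<subseteq> plane_lines \<and> (\<forall>l\<in>L. P \<in> l) \<and> supp c \<subseteq> \<Union>L \<and>
     (\<forall>l\<in>L. \<not> (\<lambda>Q. c $ Q) constant_on (l - {P}))"

definition odd_codeword :: "nat \<Rightarrow> 'a::{field, finite} ^ 'a point \<Rightarrow> bool" where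
  "odd_codeword n c \<longleftrightarrow> (\<exists>P L. card L = n \<and> odd_codeword_with P L c)"

end

theory Submission
  imports Defs "Jordan_Normal_Form.Determinant"
begin

text \<open>
  Let \<open>S\<close> be the support of the codeword \<open>c\<close> and \<open>q\<close> the order of the field. In affine coordinates in which
  the lines through a point \<open>N\<close> are the lines \<open>y = const\<close>, the moment \<open>\<Sum>x. c(x,y) x^i\<close> is a polynomial in
  \<open>y\<close> of degree at most \<open>i\<close>. Hence the determinant of the \<open>s \<times> s\<close> Hankel matrix of these moments has degree
  at most \<open>s (s - 1)\<close>. It does not vanish at a line with exactly \<open>s\<close> points of \<open>S - {N}\<close>, and it vanishes to
  order at least \<open>s - s'\<close> at a line with \<open>s' < s\<close> of them. Counting roots gives \<open>s (q + 1 - s) \<le> wt c\<close>.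

  For the given weights it follows that a line meets \<open>S\<close> in at most 4 or in at least \<open>q - 3\<close> points, and at
  most four lines are of the second kind. They cover \<open>S\<close>: if all lines through a point of \<open>S\<close> have at most
  \<open>t\<close> points of \<open>S\<close>, then \<open>wt c \<le> 1 + (t - 1)(q + 1)\<close>, the inequality above replaces \<open>t\<close> by \<open>t - 1\<close>, and so on
  down to a contradiction.

  Finally, \<open>c\<close> is orthogonal to all forms of degree \<open>q - 1\<close>. Taking products of linear forms shows that
  \<open>c\<close> is constant on the points of a line of the cover that lie on no other one, provided the other lines
  meet it in distinct points. Such a line can be subtracted, which leaves only concurrent lines.
\<close>

no_notation Matrix.vec_index (infixl "$" 100)

section \<open>Power sums and Hankel determinants\<close>

lemma of_nat_card_field_eq_0: "of_nat CARD('a) = (0 :: 'a::{field, finite})"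
proof -
  have "(\<Sum>x\<in>UNIV. x) = (\<Sum>x\<in>UNIV. x + (1::'a))"
    by (rule sum.reindex_bij_witness[of _ "\<lambda>x. x + 1" "\<lambda>x. x - 1"]) auto
  then show ?thesis
    by (simp add: sum.distrib)
qed

lemma power_card_minus_1:
  fixes x :: "'a::{field, finite}"
  assumes "x \<noteq> 0"
  shows "x ^ (CARD('a) - 1) = 1"
proof -
  have "(\<Prod>y\<in>UNIV - {0}. y) = (\<Prod>y\<in>UNIV - {0}. x * y)"
    by (rule prod.reindex_bij_witness[of _ "\<lambda>y. x * y" "\<lambda>y. y / x"]) (use assms in auto)
  also have "\<dots> = x ^ (CARD('a) - 1) * (\<Prod>y\<in>UNIV - {0}. y)"
    by (simp add: prod.distrib card_Diff_singleton)
  finally show ?thesis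
    by simp
qed

lemma card_field_ge_2: "CARD('a::{field, finite}) \<ge> 2"
proof -
  have "card {0, 1 :: 'a} \<le> CARD('a)"
    by (intro card_mono) auto
  then show ?thesis by simp
qed

text \<open>Scaling by a unit \<open>a\<close> permutes the field and multiplies the sum by
  \<open>a ^ i\<close>; for \<open>0 < i < CARD('a) - 1\<close> some \<open>a\<close> has
  \<open>a ^ i\<close> different from 1, which forces the sum to vanish. For \<open>i = 0\<close>
  the convention \<open>0 ^ 0 = 1\<close> turns the sum into the order of the field, which is 0 in
  the field.\<close>

lemma sum_power_field:
  fixes i :: nat
  assumes "i \<le> CARD('a) - 1"
  shows "(\<Sum>x\<in>UNIV. x ^ i) = (if i = CARD('a) - 1 then - 1 else (0 :: 'a::{field, finite}))"
proof -
  consider "i = CARD('a) - 1" | "i = 0" "i < CARD('a) - 1" | "0 < i" "i < CARD('a) - 1"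
    using assms by linarith
  then show ?thesis
  proof cases
    case 1
    then have "i > 0"
      using card_field_ge_2[where 'a = 'a] by simp
    have "(\<Sum>x\<in>UNIV. x ^ i) = (\<Sum>x\<in>UNIV - {0}. x ^ i) + (0 :: 'a) ^ i"
      by (subst sum.remove[of _ 0]) (auto simp: add.commute)
    also have "(\<Sum>x\<in>UNIV - {0::'a}. x ^ i) = (\<Sum>x\<in>UNIV - {0::'a}. 1)"
      by (rule sum.cong) (auto simp: 1 power_card_minus_1 simp del: One_nat_def)
    also have "\<dots> = of_nat CARD('a) - 1"
      by (simp add: card_Diff_singleton of_nat_diff)
    finally show ?thesis
      using 1 \<open>i > 0\<close> by (simp add: of_nat_card_field_eq_0)
  next
    case 2
    then show ?thesis
      by (simp add: of_nat_card_field_eq_0)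
  next
    case 3
    \<comment> \<open>Since \<open>f\<close> has at most \<open>i\<close> roots, fewer than there
      are nonzero elements, some nonzero \<open>a\<close> is not a root.\<close>
    define f :: "'a poly" where "f = monom 1 i - 1"
    have deg: "degree f = i"
    proof -
      have "degree f = degree (monom (1::'a) i)"
        unfolding f_def diff_conv_add_uminus by (rule degree_add_eq_left) (use 3 in \<open>simp add: degree_monom_eq\<close>)
      then show ?thesis by (simp add: degree_monom_eq)
    qed
    then have "f \<noteq> 0" using 3 by auto
    then have "card {x. poly f x = 0} \<le> i"
      using card_poly_roots_bound deg by metis
    also have "i < card (UNIV - {0 :: 'a})"
      using 3 by (simp add: card_Diff_singleton)
    finally have "\<not> UNIV - {0} \<subseteq> {x. poly f x = 0}"
      by (meson card_mono finite not_le)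
    then obtain a where "a \<noteq> 0" "poly f a \<noteq> 0"
      by blast
    then have a: "a \<noteq> 0" "a ^ i \<noteq> 1"
      by (simp_all add: f_def poly_monom)
    have "(\<Sum>x\<in>UNIV. x ^ i) = (\<Sum>x\<in>UNIV. (a * x) ^ i)"
      by (rule sum.reindex_bij_witness[of _ "\<lambda>y. a * y" "\<lambda>y. y / a"]) (use a in auto)
    also have "\<dots> = a ^ i * (\<Sum>x\<in>UNIV. x ^ i)"
      by (simp add: power_mult_distrib sum_distrib_left)
    finally show ?thesis
      using a 3 by simp
  qed
qed

lemma poly_eq_sum_coeff_bound:
  fixes p :: "'a::comm_ring_1 poly"
  assumes "degree p < s"
  shows "poly p x = (\<Sum>j<s. coeff p j * x ^ j)"
proof -
  have "(\<Sum>j\<le>degree p. coeff p j * x ^ j) = (\<Sum>j<s. coeff p j * x ^ j)"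
    by (rule sum.mono_neutral_left) (use assms in \<open>auto simp: coeff_eq_0\<close>)
  then show ?thesis
    by (simp add: poly_altdef)
qed

text \<open>After expansion in monomials only the power sum of exponent \<open>CARD('a) - 1\<close>
  survives, and it equals -1.\<close>

lemma sum_poly_field:
  fixes f :: "'a::{field, finite} poly"
  assumes "degree f \<le> CARD('a) - 1"
  shows "(\<Sum>x\<in>UNIV. poly f x) = - coeff f (CARD('a) - 1)"
proof -
  let ?n = "CARD('a) - 1"
  have "(\<Sum>x\<in>UNIV. poly f x) = (\<Sum>x\<in>UNIV. \<Sum>i\<le>?n. coeff f i * x ^ i)"
    using assms poly_eq_sum_coeff_bound[of f "Suc ?n"]
    by (simp only: less_Suc_eq_le lessThan_Suc_atMost)
  also have "\<dots> = (\<Sum>i\<le>?n. coeff f i * (\<Sum>x\<in>UNIV. x ^ i))"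
    by (subst sum.swap) (simp add: sum_distrib_left)
  also have "\<dots> = (\<Sum>i\<le>?n. if i = ?n then - coeff f ?n else 0)"
    by (rule sum.cong) (auto simp: sum_power_field)
  also have "\<dots> = - coeff f ?n"
    by simp
  finally show ?thesis .
qed

text \<open>The degree is only bounded, and the coefficient is taken at the fixed index
  \<open>n\<close>, because factors with \<open>a j = 0\<close> lower the degree.\<close>

lemma coeff_prod_linear:
  fixes a b :: "nat \<Rightarrow> 'a::comm_ring_1"
  shows "degree (\<Prod>j<n. [:b j, a j:]) \<le> n \<and> coeff (\<Prod>j<n. [:b j, a j:]) n = (\<Prod>j<n. a j)"
proof (induction n)
  case (Suc n)
  let ?Q = "\<Prod>j<n. [:b j, a j:]"
  have "(\<Prod>j<Suc n. [:b j, a j:]) = Polynomial.smult (b n) ?Q + pCons 0 (Polynomial.smult (a n) ?Q)"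
    by (simp add: mult.commute)
  moreover have "degree (Polynomial.smult (b n) ?Q + pCons 0 (Polynomial.smult (a n) ?Q)) \<le> Suc n"
    using Suc.IH
    by (intro degree_add_le) (auto intro: order_trans[OF degree_smult_le] order_trans[OF degree_pCons_le])
  moreover have "coeff ?Q (Suc n) = 0"
    using Suc.IH by (intro coeff_eq_0) auto
  ultimately show ?case
    using Suc.IH by (simp add: mult.commute)
qed simp

lemma degree_prod_root: "degree (\<Prod>x\<in>A. [:- x, 1:: 'a::field:]) = card A"
  by (subst degree_prod_eq_sum_degree) auto

lemma lead_coeff_prod_root: "lead_coeff (\<Prod>x\<in>A. [:- x, 1:: 'a::field:]) = 1"
  by (subst lead_coeff_prod) auto

lemma sum_order_le_degree:
  fixes p :: "'a::{idom} poly"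
  assumes "p \<noteq> 0" "finite A"
  shows "(\<Sum>y\<in>A. order y p) \<le> degree p"
proof -
  have "(\<Sum>y\<in>A. order y p) = (\<Sum>y\<in>A. count (proots p) y)"
    using assms by simp
  also have "\<dots> \<le> size (proots p)"
    unfolding size_multiset_overloaded_eq
    by (subst sum.mono_neutral_right[of A "A \<inter> set_mset (proots p)"])
       (use assms(2) in \<open>auto intro!: sum_mono2 simp: not_in_iff simp del: count_proots set_count_proots\<close>)
  also have "\<dots> \<le> degree p"
    by (rule size_proots_le)
  finally show ?thesis .
qed

section \<open>Hankel matrices of moments\<close>

text \<open>A kernel vector is the coefficient vector of a polynomial of degree below
  \<open>card T\<close>. Its values on \<open>T\<close>, weighted by \<open>w\<close>, are
  orthogonal to all polynomials of degree below \<open>card T\<close>; testing with Lagrange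
  polynomials shows that it vanishes on all of \<open>T\<close>, so it is zero.\<close>

lemma hankel_nonsingular:
  fixes m :: "nat \<Rightarrow> 'a::field" and w :: "'a \<Rightarrow> 'a"
  assumes "finite T" and w: "\<And>x. x \<in> T \<Longrightarrow> w x \<noteq> 0"
    and m: "\<And>i. m i = (\<Sum>x\<in>T. w x * x ^ i)"
  shows "Determinant.det (Matrix.mat (card T) (card T) (\<lambda>(i, j). m (i + j))) \<noteq> 0"
proof
  let ?s = "card T"
  let ?H = "Matrix.mat ?s ?s (\<lambda>(i, j). m (i + j))"
  assume "Determinant.det ?H = 0"
  then obtain v where v: "v \<in> carrier_vec ?s" "v \<noteq> 0\<^sub>v ?s" "?H *\<^sub>v v = 0\<^sub>v ?s"
    using det_0_iff_vec_prod_zero[of ?H ?s] by auto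
  define q where "q x = (\<Sum>j<?s. vec_index v j * x ^ j)" for x
  have ortho: "(\<Sum>x\<in>T. w x * x ^ i * q x) = 0" if "i < ?s" for i
  proof -
    have "0 = vec_index (?H *\<^sub>v v) i"
      using v(3) that by simp
    also have "\<dots> = (\<Sum>j<?s. m (i + j) * vec_index v j)"
      using that v(1) by (auto simp: scalar_prod_def lessThan_atLeast0 intro!: sum.cong)
    also have "\<dots> = (\<Sum>x\<in>T. \<Sum>j<?s. w x * x ^ (i + j) * vec_index v j)"
      by (subst sum.swap) (simp add: m sum_distrib_right)
    also have "\<dots> = (\<Sum>x\<in>T. w x * x ^ i * q x)"
      by (simp add: q_def sum_distrib_left power_add mult_ac)
    finally show ?thesis by simp
  qed
  have q0: "q z = 0" if z: "z \<in> T" for z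
  proof -
    \<comment> \<open>Up to a factor this is the Lagrange polynomial of \<open>z\<close> on
      \<open>T\<close>; it isolates the term of \<open>z\<close> in the weighted sum.\<close>
    define h where "h = (\<Prod>x\<in>T - {z}. [:- x, 1:])"
    have deg: "degree h < ?s"
      using psubset_card_mono[of T "T - {z}"] z \<open>finite T\<close> by (auto simp: h_def degree_prod_root)
    have "0 = (\<Sum>i<?s. coeff h i * (\<Sum>x\<in>T. w x * x ^ i * q x))"
      by (simp add: ortho)
    also have "\<dots> = (\<Sum>x\<in>T. w x * q x * (\<Sum>i<?s. coeff h i * x ^ i))"
      by (simp add: sum_distrib_left sum.swap[of _ T] mult_ac)
    also have "\<dots> = (\<Sum>x\<in>T. w x * q x * poly h x)"
      by (simp add: poly_eq_sum_coeff_bound[OF deg])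
    also have "\<dots> = w z * q z * poly h z"
      using z \<open>finite T\<close> by (subst sum.remove[of _ z]) (auto simp: h_def poly_prod intro!: sum.neutral)
    finally show ?thesis
      using w[OF z] \<open>finite T\<close> by (auto simp: h_def poly_prod)
  qed
  define f where "f = (\<Sum>j<?s. monom (vec_index v j) j)"
  have coeff_f: "coeff f j = vec_index v j" if "j < ?s" for j
    using that by (simp add: f_def coeff_sum)
  have "?s > 0"
    using v(1,2) by (cases "?s") auto
  have deg_f: "degree f < ?s"
    unfolding f_def using \<open>?s > 0\<close>
    by (intro degree_sum_less) (auto intro: le_less_trans[OF degree_monom_le])
  have "poly f x = q x" for x
    by (simp add: f_def q_def poly_sum poly_monom)
  then have "T \<subseteq> {x. poly f x = 0}"
    using q0 by auto
  then have "f = 0"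
    using deg_f card_mono[OF poly_roots_finite, of f T] card_poly_roots_bound[of f] by fastforce
  then have "v = 0\<^sub>v ?s"
    using coeff_f v(1) by (intro eq_vecI) auto
  then show False
    using v(2) by simp
qed

text \<open>Every term of the Leibniz expansion takes one entry from each column, hence one factor
  \<open>d\<close> from each column in \<open>J\<close>.\<close>

lemma dvd_det_if_dvd_columns:
  fixes A :: "'a::comm_ring_1 mat"
  assumes A: "A \<in> carrier_mat n n" and J: "J \<subseteq> {..<n}"
    and dvd: "\<And>i j. i < n \<Longrightarrow> j \<in> J \<Longrightarrow> d dvd A $$ (i, j)"
  shows "d ^ card J dvd Determinant.det A"
  unfolding det_col[OF A]
proof (intro dvd_sum dvd_mult)
  fix \<pi> assume "\<pi> \<in> {\<pi>. \<pi> permutes {0..<n}}"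
  then have \<pi>: "\<pi> j < n" if "j < n" for j
    using that permutes_in_image[of \<pi> "{0..<n}" j] by auto
  have "(\<Prod>j\<in>J. d) dvd (\<Prod>j\<in>J. A $$ (\<pi> j, j))"
    by (rule prod_dvd_prod) (use J \<pi> dvd in auto)
  also have "\<dots> dvd (\<Prod>j<n. A $$ (\<pi> j, j))"
    by (rule prod_dvd_prod_subset) (use J in auto)
  finally show "d ^ card J dvd (\<Prod>j<n. A $$ (\<pi> j, j))"
    by simp
qed

text \<open>At \<open>y\<close> the moments come from \<open>card T\<close> nodes, so the evaluated
  matrix has rank at most \<open>card T\<close>, and each missing dimension contributes a factor.
  The exponent is a truncated difference, so the claim is trivial for
  \<open>s \<le> card T\<close>.\<close>

lemma root_power_dvd_hankel:
  fixes P :: "nat \<Rightarrow> 'a::field poly" and w :: "'a \<Rightarrow> 'a"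
  assumes "finite T" and m: "\<And>i. poly (P i) y = (\<Sum>x\<in>T. w x * x ^ i)"
  shows "[:- y, 1:] ^ (s - card T) dvd Determinant.det (Matrix.mat s s (\<lambda>(i, j). P (i + j)))"
proof -
  let ?r = "card T"
  let ?H = "Matrix.mat s s (\<lambda>(i, j). P (i + j))"
  define g where "g = (\<Prod>x\<in>T. [:- x, 1:])"
  have g: "degree g = ?r" "coeff g ?r = 1"
    using lead_coeff_prod_root[of T] by (simp_all add: g_def degree_prod_root)
  \<comment> \<open>The unitriangular column operation given by the coefficients of \<open>f j\<close> turns column \<open>j\<close> into the moments
    of \<open>f j\<close>; these vanish at \<open>y\<close> for \<open>j \<ge> card T\<close>, since \<open>f j\<close> vanishes on \<open>T\<close>.\<close>
  define f where "f j = (if j < ?r then monom 1 j else monom 1 (j - ?r) * g)" for j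
  have deg_f: "degree (f j) \<le> j" for j
    using degree_mult_le[of "monom 1 (j - ?r)" g] g(1)
    by (auto simp: f_def degree_monom_eq)
  have lead_f: "coeff (f j) j = 1" for j
    by (auto simp: f_def coeff_monom_mult g)
  define U :: "'a poly mat" where "U = Matrix.mat s s (\<lambda>(i, j). [:coeff (f j) i:])"
  have U: "U \<in> carrier_mat s s" and H: "?H \<in> carrier_mat s s"
    by (simp_all add: U_def)
  have "upper_triangular U"
    using coeff_eq_0[OF le_less_trans[OF deg_f]] by (auto simp: U_def upper_triangular_def)
  then have "Determinant.det U = prod_list (diag_mat U)"
    using U by (rule det_upper_triangular)
  also have "diag_mat U = map (\<lambda>_. 1) [0..<s]"
    by (auto simp: diag_mat_def U_def lead_f one_pCons)
  also have "prod_list \<dots> = 1"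
    by (induction s) auto
  finally have "Determinant.det ?H = Determinant.det (?H * U)"
    using det_mult[OF H U] by simp
  moreover have "[:- y, 1:] ^ card {?r..<s} dvd Determinant.det (?H * U)"
  proof (rule dvd_det_if_dvd_columns)
    show "?H * U \<in> carrier_mat s s"
      by (rule mult_carrier_mat[OF H U])
    fix i j assume "i < s" and j: "j \<in> {?r..<s}"
    have "(?H * U) $$ (i, j) = (\<Sum>k<s. P (i + k) * [:coeff (f j) k:])"
      using \<open>i < s\<close> j by (auto simp: U_def scalar_prod_def lessThan_atLeast0 intro!: sum.cong)
    then have "poly ((?H * U) $$ (i, j)) y = (\<Sum>k<s. (\<Sum>x\<in>T. w x * x ^ (i + k)) * coeff (f j) k)"
      by (simp add: poly_sum m mult.commute)
    also have "\<dots> = (\<Sum>x\<in>T. w x * x ^ i * (\<Sum>k<s. coeff (f j) k * x ^ k))"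
      by (simp add: sum_distrib_left sum_distrib_right sum.swap[of _ T] power_add mult_ac)
    also have "\<dots> = (\<Sum>x\<in>T. w x * x ^ i * poly (f j) x)"
      using j poly_eq_sum_coeff_bound[of "f j" s] le_less_trans[OF deg_f, of j s] by simp
    also have "\<dots> = 0"
      using j \<open>finite T\<close> by (auto simp: f_def g_def poly_prod intro!: sum.neutral)
    finally show "[:- y, 1:] dvd (?H * U) $$ (i, j)"
      by (simp add: poly_eq_0_iff_dvd)
  qed auto
  ultimately show ?thesis
    by simp
qed

text \<open>The entry at \<open>(i, j)\<close> has degree at most \<open>i + j\<close>, and in each
  Leibniz term the row indices and the column indices both run once through all numbers below
  \<open>s\<close>.\<close>

lemma degree_hankel_le:
  fixes P :: "nat \<Rightarrow> 'a::comm_ring_1 poly"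
  assumes "\<And>i. degree (P i) \<le> i"
  shows "degree (Determinant.det (Matrix.mat s s (\<lambda>(i, j). P (i + j)))) \<le> s * (s - 1)"
proof -
  let ?H = "Matrix.mat s s (\<lambda>(i, j). P (i + j))"
  have "degree (of_int (sign \<pi>) * (\<Prod>j<s. ?H $$ (\<pi> j, j))) \<le> s * (s - 1)"
    if \<pi>: "\<pi> permutes {0..<s}" for \<pi>
  proof -
    have lt: "\<pi> j < s" if "j < s" for j
      using that permutes_in_image[OF \<pi>, of j] by auto
    have "degree (of_int (sign \<pi>) * (\<Prod>j<s. ?H $$ (\<pi> j, j))) \<le> degree (\<Prod>j<s. ?H $$ (\<pi> j, j))"
      by (cases \<pi> rule: sign_cases) (auto)
    also have "\<dots> \<le> (\<Sum>j<s. degree (?H $$ (\<pi> j, j)))"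
      using degree_prod_sum_le[of "{..<s}" "\<lambda>j. ?H $$ (\<pi> j, j)"] by (simp add: o_def)
    also have "\<dots> \<le> (\<Sum>j<s. \<pi> j + j)"
      using lt assms by (intro sum_mono) auto
    also have "\<dots> = (\<Sum>j<s. j) + (\<Sum>j<s. j)"
      using sum.permute[OF \<pi>, of "\<lambda>j. j"] by (simp add: sum.distrib lessThan_atLeast0)
    also have "\<dots> = s * (s - 1)"
      by (induction s) (auto simp: algebra_simps)
    finally show ?thesis .
  qed
  then show ?thesis
    unfolding det_col[of ?H s, OF mat_carrier] by (intro degree_sum_le) (auto simp: finite_permutations)
qed

text \<open>The determinant is a nonzero polynomial, since at \<open>z\<close> it is the Hankel
  determinant of exactly \<open>s\<close> nodes with nonzero weights. Its roots, counted with
  multiplicity, are compared with its degree.\<close>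

lemma hankel_count:
  fixes F :: "'a::{field, finite} \<Rightarrow> 'a \<Rightarrow> 'a" and P :: "nat \<Rightarrow> 'a poly"
  assumes deg: "\<And>i. degree (P i) \<le> i"
    and P: "\<And>i y. poly (P i) y = (\<Sum>x\<in>UNIV. F x y * x ^ i)"
    and s: "s = card {x. F x z \<noteq> 0}"
  shows "(\<Sum>y\<in>UNIV. s - card {x. F x y \<noteq> 0}) \<le> s * (s - 1)"
proof -
  let ?T = "\<lambda>y. {x. F x y \<noteq> 0}"
  let ?H = "Matrix.mat s s (\<lambda>(i, j). P (i + j))"
  have P': "poly (P i) y = (\<Sum>x\<in>?T y. F x y * x ^ i)" for i y
    unfolding P by (rule sum.mono_neutral_right) auto
  \<comment> \<open>Evaluation at \<open>z\<close> is a ring homomorphism and therefore commutes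
    with the determinant.\<close>
  interpret ev: comm_ring_hom "\<lambda>p. poly p z"
    by unfold_locales auto
  have "poly (Determinant.det ?H) z = Determinant.det (map_mat (\<lambda>p. poly p z) ?H)"
    by simp
  also have "map_mat (\<lambda>p. poly p z) ?H = Matrix.mat s s (\<lambda>(i, j). poly (P (i + j)) z)"
    by (intro eq_matI) auto
  also have "Determinant.det \<dots> \<noteq> 0"
    unfolding s by (rule hankel_nonsingular[of _ "\<lambda>x. F x z"]) (auto simp: P')
  finally have nz: "Determinant.det ?H \<noteq> 0"
    by auto
  have "(\<Sum>y\<in>UNIV. s - card (?T y)) \<le> (\<Sum>y\<in>UNIV. order y (Determinant.det ?H))"
  proof (intro sum_mono)
    fix y
    have "[:- y, 1:] ^ (s - card (?T y)) dvd Determinant.det ?H"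
      by (rule root_power_dvd_hankel[of _ _ _ "\<lambda>x. F x y"]) (auto simp: P')
    then show "s - card (?T y) \<le> order y (Determinant.det ?H)"
      using nz by (simp add: order_divides)
  qed
  also have "\<dots> \<le> degree (Determinant.det ?H)"
    by (rule sum_order_le_degree) (use nz in auto)
  also have "\<dots> \<le> s * (s - 1)"
    by (rule degree_hankel_le) (rule deg)
  finally show ?thesis .
qed

section \<open>Coordinates in the projective plane\<close>

text \<open>Homogeneous coordinates. For \<open>u = 0\<close> the span has dimension 0 and the value
  is unspecified, hence the recurring assumption \<open>u \<noteq> 0\<close>.\<close>

definition proj_point :: "'a::field ^ 3 \<Rightarrow> 'a point" where
  "proj_point u = Abs_point (vec.span {u})"

definition pairing :: "'a::field ^ 3 \<Rightarrow> 'a ^ 3 \<Rightarrow> 'a" where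
  "pairing a u = (\<Sum>i\<in>UNIV. a $ i * u $ i)"

lemma pairing_add [simp]: "pairing a (u + v) = pairing a u + pairing a v"
  by (simp add: pairing_def sum.distrib algebra_simps)

lemma pairing_scale [simp]: "pairing a (k *s u) = k * pairing a u"
  by (simp add: pairing_def sum_distrib_left algebra_simps)

lemma pairing_zero [simp]: "pairing a 0 = 0"
  by (simp add: pairing_def)

lemma pairing_diff [simp]: "pairing a (u - v) = pairing a u - pairing a v"
  by (simp add: pairing_def sum_subtractf algebra_simps)

lemma pairing_axis [simp]: "pairing a (axis i 1) = a $ i"
  by (simp add: pairing_def axis_def if_distrib cong: if_cong)

lemma point_subspace_proj_point: "u \<noteq> 0 \<Longrightarrow> point_subspace (proj_point u) = vec.span {u}"
  unfolding proj_point_def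
  by (subst Abs_point_inverse)
     (use vec.dim_span_eq_card_independent[of "{u}"] in \<open>auto simp: vec.subspace_span\<close>)

lemma proj_point_cases:
  obtains u where "u \<noteq> 0" "P = proj_point u"
proof -
  have P: "vec.subspace (point_subspace P)" "vec.dim (point_subspace P) = 1"
    using point_subspace[of P] by auto
  obtain B where B: "B \<subseteq> point_subspace P" "vec.independent B" "point_subspace P \<subseteq> vec.span B"
      "card B = vec.dim (point_subspace P)"
    using vec.basis_exists by blast
  then obtain u where u: "B = {u}"
    using P(2) by (auto simp: card_1_singleton_iff)
  then have "u \<noteq> 0"
    using B(2) by auto
  moreover have "point_subspace P = vec.span {u}"
    using B u P(1) vec.span_minimal by blast
  then have "P = proj_point u"
    using \<open>u \<noteq> 0\<close> point_subspace_inject point_subspace_proj_point by metis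
  ultimately show ?thesis
    using that by blast
qed

lemma proj_point_eq_iff:
  assumes "u \<noteq> 0" "v \<noteq> 0"
  shows "proj_point u = proj_point v \<longleftrightarrow> (\<exists>k. k \<noteq> 0 \<and> u = k *s v)"
proof
  assume "proj_point u = proj_point v"
  then have "vec.span {u} = vec.span {v}"
    using assms point_subspace_proj_point by metis
  then have "u \<in> vec.span {v}"
    using vec.span_base by blast
  then show "\<exists>k. k \<noteq> 0 \<and> u = k *s v"
    using assms by (auto simp: vec.span_singleton)
next
  assume "\<exists>k. k \<noteq> 0 \<and> u = k *s v"
  then obtain k where k: "k \<noteq> 0" "u = k *s v"
    by blast
  have "vec.span {u} = vec.span {v}"
  proof (rule antisym; rule vec.span_minimal)
    show "{u} \<subseteq> vec.span {v}" "{v} \<subseteq> vec.span {u}"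
      using k by (auto simp: vec.span_singleton intro: rev_image_eqI[of "inverse k"])
  qed auto
  then show "proj_point u = proj_point v"
    by (simp add: proj_point_def)
qed

lemma proj_point_scale: "k \<noteq> 0 \<Longrightarrow> u \<noteq> 0 \<Longrightarrow> proj_point (k *s u) = proj_point u"
  by (subst proj_point_eq_iff) auto

text \<open>A basis together with its dual basis. In its uses \<open>e1\<close> spans a chosen
  point, \<open>a2\<close> is an equation of a chosen line through it, and \<open>a3 = 1\<close> is
  the affine chart in which \<open>x *s e1 + y *s e2 + e3\<close> has coordinates
  \<open>(x, y)\<close>.\<close>

definition frame ::
    "'a::field ^ 3 \<Rightarrow> 'a ^ 3 \<Rightarrow> 'a ^ 3 \<Rightarrow> 'a ^ 3 \<Rightarrow> 'a ^ 3 \<Rightarrow> 'a ^ 3 \<Rightarrow> bool" where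
  "frame e1 e2 e3 a1 a2 a3 \<longleftrightarrow>
     (\<forall>u. u = pairing a1 u *s e1 + pairing a2 u *s e2 + pairing a3 u *s e3) \<and>
     pairing a1 e1 = 1 \<and> pairing a1 e2 = 0 \<and> pairing a1 e3 = 0 \<and>
     pairing a2 e1 = 0 \<and> pairing a2 e2 = 1 \<and> pairing a2 e3 = 0 \<and>
     pairing a3 e1 = 0 \<and> pairing a3 e2 = 0 \<and> pairing a3 e3 = 1"

lemma frame_nonzero:
  assumes "frame e1 e2 e3 a1 a2 a3"
  shows "e1 \<noteq> 0" "e2 \<noteq> 0" "e3 \<noteq> 0" "a1 \<noteq> 0" "a2 \<noteq> 0" "a3 \<noteq> 0"
  using assms by (auto simp: frame_def) (auto simp: pairing_def)

lemma frame_expand: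
  assumes "frame e1 e2 e3 a1 a2 a3"
  shows "u = pairing a1 u *s e1 + pairing a2 u *s e2 + pairing a3 u *s e3"
  using assms unfolding frame_def by blast

lemma frame_pairing:
  assumes "frame e1 e2 e3 a1 a2 a3"
  shows "pairing a1 e1 = 1" "pairing a1 e2 = 0" "pairing a1 e3 = 0"
    "pairing a2 e1 = 0" "pairing a2 e2 = 1" "pairing a2 e3 = 0"
    "pairing a3 e1 = 0" "pairing a3 e2 = 0" "pairing a3 e3 = 1"
  using assms unfolding frame_def by blast+

lemma frame_affine_nonzero:
  assumes "frame e1 e2 e3 a1 a2 a3"
  shows "x *s e1 + y *s e2 + e3 \<noteq> 0"
proof
  assume "x *s e1 + y *s e2 + e3 = 0"
  then have "pairing a3 (x *s e1 + y *s e2 + e3) = 0"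
    by simp
  then show False
    by (simp add: frame_pairing[OF assms])
qed

text \<open>The vector \<open>e1\<close> is extended by \<open>e3\<close> to a basis of
  \<open>W\<close> and then by \<open>e2\<close> to a basis of the whole space. The dual basis
  consists of the coordinate functions, and \<open>W\<close> is where the coordinate of
  \<open>e2\<close> vanishes.\<close>

lemma frame_exists:
  fixes W :: "('a::field ^ 3) set"
  assumes W: "vec.subspace W" "vec.dim W = 2" and e1: "e1 \<in> W" "e1 \<noteq> 0"
  obtains e2 e3 a1 a2 a3 where "frame e1 e2 e3 a1 a2 a3" "W = {u. pairing a2 u = 0}"
proof -
  obtain B where B: "{e1} \<subseteq> B" "B \<subseteq> W" "vec.independent B" "W \<subseteq> vec.span B"
    by (rule vec.maximal_independent_subset_extend[of "{e1}" W]) (use e1 in auto)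
  have "card B = 2"
    using vec.basis_card_eq_dim[OF B(2,4,3)] W(2) by simp
  then have "card (B - {e1}) = 1"
    using B(1) by simp
  then obtain e3 where "B - {e1} = {e3}"
    by (auto simp: card_1_singleton_iff)
  then have B_eq: "B = {e1, e3}" "e1 \<noteq> e3"
    using B(1) by auto
  obtain C where C: "B \<subseteq> C" "vec.independent C" "UNIV \<subseteq> vec.span C"
    by (rule vec.maximal_independent_subset_extend[OF subset_UNIV B(3)])
  have "card C = 3"
    using vec.basis_card_eq_dim[OF _ C(3,2)] by (simp add: vec_dim_card card_cart_basis)
  then have "card (C - B) = 1"
    using C(1) \<open>card B = 2\<close> B_eq by (simp add: card_Diff_subset)
  then obtain e2 where "C - B = {e2}"
    by (auto simp: card_1_singleton_iff)
  then have C_eq: "C = {e1, e2, e3}" "e2 \<noteq> e1" "e2 \<noteq> e3"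
    using C(1) B_eq by auto
  let ?r = "vec.representation C"
  \<comment> \<open>The coordinate function of \<open>e\<close> as a vector, obtained from its
    values on the standard basis.\<close>
  define a where "a e = (\<chi> i. ?r (axis i 1) e)" for e
  have sp: "u \<in> vec.span C" for u
    using C(3) by auto
  have r: "pairing (a e) u = ?r u e" for e u
  proof -
    have "?r u e = ?r (\<Sum>i\<in>UNIV. u $ i *s axis i 1) e"
      by (simp add: basis_expansion)
    also have "\<dots> = (\<Sum>i\<in>UNIV. ?r (u $ i *s axis i 1) e)"
      by (subst vec.representation_sum) (use C sp in auto)
    also have "\<dots> = pairing (a e) u"
      by (simp add: vec.representation_scale[OF C(2) sp] a_def pairing_def mult.commute)
    finally show ?thesis by simp
  qed
  have basis: "?r e = (\<lambda>e'. if e' = e then 1 else 0)" if "e \<in> C" for e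
    using vec.representation_basis[OF C(2) that] .
  have exp: "u = ?r u e1 *s e1 + ?r u e2 *s e2 + ?r u e3 *s e3" for u
    using vec.sum_representation_eq[OF C(2) sp, of C u] C_eq B_eq by (simp add: add_ac)
  have mem: "e1 \<in> C" "e2 \<in> C" "e3 \<in> C" and ne: "e1 \<noteq> e2" "e1 \<noteq> e3" "e2 \<noteq> e3"
    using C_eq B_eq by auto
  have fr: "frame e1 e2 e3 (a e1) (a e2) (a e3)"
    unfolding frame_def r
  proof (intro conjI allI)
    show "u = ?r u e1 *s e1 + ?r u e2 *s e2 + ?r u e3 *s e3" for u
      by (rule exp)
  qed (simp_all add: basis mem ne ne[symmetric])
  have "W = {u. pairing (a e2) u = 0}"
  proof (intro Set.set_eqI iffI; clarify?)
    fix u assume "u \<in> W"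
    then have "u \<in> vec.span {e1, e3}"
      using B B_eq by auto
    then obtain k l where "u = k *s e1 + l *s e3"
      by (auto simp: vec.span_breakdown_eq[of _ e1] vec.span_singleton algebra_simps)
    then show "pairing (a e2) u = 0"
      by (simp add: frame_pairing[OF fr])
  next
    fix u assume "pairing (a e2) u = 0"
    then have "u = pairing (a e1) u *s e1 + 0 *s e2 + pairing (a e3) u *s e3"
      using frame_expand[OF fr, of u] by (simp only:)
    also have "\<dots> = pairing (a e1) u *s e1 + pairing (a e3) u *s e3"
      by simp
    also have "\<dots> \<in> W"
      using B(2) B_eq W(1) by (intro vec.subspace_add vec.subspace_scale) auto
    finally show "u \<in> W" .
  qed
  then show ?thesis
    using that fr by simp
qed

section \<open>Lines as zero sets of linear forms, and their incidence\<close>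

definition has_equation :: "'a::field point set \<Rightarrow> 'a ^ 3 \<Rightarrow> bool" where
  "has_equation l a \<longleftrightarrow> (\<forall>u. u \<noteq> 0 \<longrightarrow> (proj_point u \<in> l \<longleftrightarrow> pairing a u = 0))"

lemma has_equationD: "has_equation l a \<Longrightarrow> u \<noteq> 0 \<Longrightarrow> proj_point u \<in> l \<longleftrightarrow> pairing a u = 0"
  by (simp add: has_equation_def)

lemma plane_line_equation:
  assumes "l \<in> plane_lines" "e1 \<noteq> 0" "proj_point e1 \<in> l"
  obtains e2 e3 a1 a2 a3 where "frame e1 e2 e3 a1 a2 a3"
    "has_equation l a2"
proof -
  obtain W where W: "vec.subspace W" "vec.dim W = 2" and l: "l = {P. point_subspace P \<subseteq> W}"
    using assms(1) by (auto simp: plane_lines_def)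
  have mem: "proj_point u \<in> l \<longleftrightarrow> u \<in> W" if "u \<noteq> 0" for u
    using that W(1) vec.span_minimal[of "{u}" W] vec.span_base[of u "{u}"]
    by (auto simp: l point_subspace_proj_point)
  obtain e2 e3 a1 a2 a3 where "frame e1 e2 e3 a1 a2 a3" "W = {u. pairing a2 u = 0}"
    by (rule frame_exists[OF W _ assms(2)]) (use mem[OF assms(2)] assms(3) in simp)
  then show ?thesis
    by (intro that[of e2 e3 a1 a2 a3]) (simp_all add: mem has_equation_def)
qed

lemma plane_line_nonempty:
  assumes "l \<in> plane_lines"
  obtains u where "u \<noteq> 0" "proj_point u \<in> l"
proof -
  obtain W where W: "vec.subspace W" "vec.dim W = 2" and l: "l = {P. point_subspace P \<subseteq> W}"
    using assms by (auto simp: plane_lines_def)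
  obtain u where "u \<in> W" "u \<noteq> 0"
    using W(2) vec.dim_eq_0[of W] by auto
  then show ?thesis
    using that W(1) vec.span_minimal[of "{u}" W] by (auto simp: l point_subspace_proj_point)
qed

lemma plane_line_has_equation:
  assumes "l \<in> plane_lines"
  obtains b where "b \<noteq> 0" "has_equation l b"
proof -
  obtain u where u: "u \<noteq> 0" "proj_point u \<in> l"
    using plane_line_nonempty[OF assms] .
  obtain e2 e3 a1 a2 a3 where fr: "frame u e2 e3 a1 a2 a3"
    and l: "has_equation l a2"
    using plane_line_equation[OF assms u] by blast
  show ?thesis
    by (rule that[OF frame_nonzero(5)[OF fr] l])
qed

lemma plane_line_join:
  assumes "u \<noteq> 0" "v \<noteq> 0" "proj_point u \<noteq> proj_point v"
  obtains l where "l \<in> plane_lines"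
    "\<And>x y. x *s u + y *s v \<noteq> 0 \<Longrightarrow> proj_point (x *s u + y *s v) \<in> l"
proof -
  have "u \<notin> vec.span {v}"
    using assms by (auto simp: vec.span_singleton proj_point_eq_iff)
  then have ind: "vec.independent {u, v}" "u \<noteq> v"
    using assms(2) vec.span_base[of v "{v}"] by (auto simp: vec.independent_insert)
  let ?W = "vec.span {u, v}"
  have "vec.dim ?W = 2"
    using vec.dim_span_eq_card_independent[OF ind(1)] ind(2) by simp
  then have "{P. point_subspace P \<subseteq> ?W} \<in> plane_lines"
    by (auto simp: plane_lines_def intro!: exI[of _ ?W])
  moreover have "proj_point (x *s u + y *s v) \<in> {P. point_subspace P \<subseteq> ?W}"
    if "x *s u + y *s v \<noteq> 0" for x y
  proof -
    have "x *s u + y *s v \<in> ?W"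
      by (intro vec.span_add vec.span_scale vec.span_base) auto
    then show ?thesis
      using that vec.span_minimal[of "{x *s u + y *s v}" ?W] by (simp add: point_subspace_proj_point)
  qed
  ultimately show ?thesis
    by (rule that)
qed

lemma plane_line_through:
  fixes P Q :: "'a::field point"
  assumes "P \<noteq> Q"
  obtains l where "l \<in> plane_lines" "P \<in> l" "Q \<in> l"
proof -
  obtain u v where uv: "u \<noteq> 0" "P = proj_point u" "v \<noteq> 0" "Q = proj_point v"
    using proj_point_cases[of P] proj_point_cases[of Q] by metis
  obtain l where l: "l \<in> plane_lines" "\<And>x y. x *s u + y *s v \<noteq> 0 \<Longrightarrow> proj_point (x *s u + y *s v) \<in> l"
    by (rule plane_line_join[OF uv(1,3)]) (use assms uv(2,4) in auto)
  show ?thesis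
    using that[OF l(1)] l(2)[of 1 0] l(2)[of 0 1] uv by simp
qed

text \<open>On the line, \<open>e1\<close> is the point at infinity and \<open>e3\<close> the
  origin; normalising the coordinate \<open>a3\<close> to 1 makes the affine parameter
  unique.\<close>

lemma plane_line_param:
  assumes fr: "frame e1 e2 e3 a1 a2 a3"
    and l: "has_equation l a2"
  shows "l - {proj_point e1} = range (\<lambda>x. proj_point (x *s e1 + e3))"
    "inj (\<lambda>x. proj_point (x *s e1 + e3))" "proj_point e1 \<in> l"
    "x *s e1 + e3 \<noteq> 0"
proof -
  note nz = frame_affine_nonzero[OF fr]
  have nz': "x *s e1 + e3 \<noteq> 0" for x
    using nz[of x 0] by simp
  then show "x *s e1 + e3 \<noteq> 0" .
  show N: "proj_point e1 \<in> l"
    using has_equationD[OF l frame_nonzero(1)[OF fr]] by (simp add: frame_pairing[OF fr])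
  show "inj (\<lambda>x. proj_point (x *s e1 + e3))"
  proof (rule injI)
    fix x y assume "proj_point (x *s e1 + e3) = proj_point (y *s e1 + e3)"
    then obtain k where k: "x *s e1 + e3 = k *s (y *s e1 + e3)"
      using proj_point_eq_iff[OF nz' nz'] by blast
    show "x = y"
      using arg_cong[OF k, of "pairing a3"] arg_cong[OF k, of "pairing a1"] by (simp add: frame_pairing[OF fr])
  qed
  show "l - {proj_point e1} = range (\<lambda>x. proj_point (x *s e1 + e3))"
  proof (intro Set.set_eqI iffI)
    fix P assume P: "P \<in> l - {proj_point e1}"
    obtain u where u: "u \<noteq> 0" "P = proj_point u"
      by (rule proj_point_cases)
    define \<alpha> \<gamma> where "\<alpha> = pairing a1 u" and "\<gamma> = pairing a3 u"
    have "pairing a2 u = 0"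
      using P u has_equationD[OF l u(1)] by blast
    from frame_expand[OF fr, of u, unfolded this] have "u = \<alpha> *s e1 + 0 *s e2 + \<gamma> *s e3"
      unfolding \<alpha>_def \<gamma>_def .
    then have eq: "u = \<alpha> *s e1 + \<gamma> *s e3"
      by simp
    have "\<gamma> \<noteq> 0"
    proof
      assume "\<gamma> = 0"
      then have "P = proj_point e1"
        using eq u proj_point_scale[of \<alpha> e1] frame_nonzero[OF fr] by auto
      then show False using P by simp
    qed
    then have "u = \<gamma> *s ((\<alpha> / \<gamma>) *s e1 + e3)"
      by (simp add: eq vec.scale_right_distrib)
    then have "P = proj_point ((\<alpha> / \<gamma>) *s e1 + e3)"
      using proj_point_scale[OF \<open>\<gamma> \<noteq> 0\<close> nz'] by (simp only: u(2))
    then show "P \<in> range (\<lambda>x. proj_point (x *s e1 + e3))"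
      by blast
  next
    fix P assume "P \<in> range (\<lambda>x. proj_point (x *s e1 + e3))"
    then obtain x where P: "P = proj_point (x *s e1 + e3)"
      by blast
    have "P \<in> l"
      unfolding P using has_equationD[OF l nz'] by (simp add: frame_pairing[OF fr])
    moreover have "P \<noteq> proj_point e1"
    proof
      assume "P = proj_point e1"
      then obtain k where k: "x *s e1 + e3 = k *s e1"
        unfolding P using proj_point_eq_iff[OF nz' frame_nonzero(1)[OF fr]] by blast
      show False
        using arg_cong[OF k, of "pairing a3"] by (simp add: frame_pairing[OF fr])
    qed
    ultimately show "P \<in> l - {proj_point e1}"
      by simp
  qed
qed

lemma card_plane_line:
  fixes l :: "'a::{field, finite} point set"
  assumes "l \<in> plane_lines"
  shows "card l = CARD('a) + 1"
proof -
  obtain u where u: "u \<noteq> 0" "proj_point u \<in> l"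
    using plane_line_nonempty[OF assms] .
  obtain e2 e3 a1 a2 a3 where fr: "frame u e2 e3 a1 a2 a3"
    and l: "has_equation l a2"
    using plane_line_equation[OF assms u] by blast
  note p = plane_line_param[OF fr l]
  have "card (l - {proj_point u}) = CARD('a)"
    by (simp add: p(1) card_image[OF p(2)])
  then show ?thesis
    using card_Suc_Diff1[of l "proj_point u"] u(2) by simp
qed

lemma plane_lines_meet:
  assumes "l \<in> plane_lines" "l' \<in> plane_lines"
  shows "l \<inter> l' \<noteq> {}"
proof -
  obtain u where u: "u \<noteq> 0" "proj_point u \<in> l"
    using plane_line_nonempty[OF assms(1)] .
  obtain e2 e3 a1 a2 a3 where fr: "frame u e2 e3 a1 a2 a3"
    and l: "has_equation l a2"
    using plane_line_equation[OF assms(1) u] by blast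
  obtain b where b: "has_equation l' b"
    using plane_line_has_equation[OF assms(2)] by blast
  show ?thesis
  proof (cases "pairing b u = 0")
    case True
    then show ?thesis
      using u has_equationD[OF b] by blast
  next
    case False
    \<comment> \<open>Along the parametrised line \<open>l\<close> the equation of \<open>l'\<close>
      is affine with nonzero slope; \<open>x\<close> is its root.\<close>
    define x where "x = - pairing b e3 / pairing b u"
    have "pairing b (x *s u + e3) = 0"
      using False by (simp add: x_def)
    then have "proj_point (x *s u + e3) \<in> l \<inter> l'"
      using has_equationD[OF l, of "x *s u + e3"] has_equationD[OF b, of "x *s u + e3"] plane_line_param(4)[OF fr l] by (simp add: frame_pairing[OF fr])
    then show ?thesis by blast
  qed
qed

lemma plane_line_subset_eq:
  assumes "l \<in> plane_lines" "l' \<in> plane_lines" "P \<noteq> Q" "P \<in> l" "Q \<in> l" "P \<in> l'" "Q \<in> l'"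
  shows "l \<subseteq> l'"
proof -
  obtain u where u: "u \<noteq> 0" "P = proj_point u"
    by (rule proj_point_cases)
  obtain e2 e3 a1 a2 a3 where fr: "frame u e2 e3 a1 a2 a3"
    and l: "has_equation l a2"
    using plane_line_equation[OF assms(1) u(1)] u(2) assms(4) by blast
  note p = plane_line_param[OF fr l]
  obtain b where b: "has_equation l' b"
    using plane_line_has_equation[OF assms(2)] by blast
  have bu: "pairing b u = 0"
    using has_equationD[OF b] u assms(6) by blast
  obtain x where "Q = proj_point (x *s u + e3)"
    using p(1) assms(3,5) u by blast
  then have be3: "pairing b e3 = 0"
    using has_equationD[OF b p(4)] assms(7) bu by simp
  have "proj_point (x *s u + e3) \<in> l'" for x
    using has_equationD[OF b p(4)] bu be3 by simp
  note * = this
  have "R \<in> l'" if R: "R \<in> l" "R \<noteq> P" for R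
  proof -
    obtain y where "R = proj_point (y *s u + e3)"
      using p(1) R u by blast
    then show ?thesis
      using * by simp
  qed
  then show ?thesis
    using assms(6) by blast
qed

lemma plane_lines_eqI:
  assumes "l \<in> plane_lines" "l' \<in> plane_lines" "P \<noteq> Q" "P \<in> l" "Q \<in> l" "P \<in> l'" "Q \<in> l'"
  shows "l = l'"
  by (rule subset_antisym[OF plane_line_subset_eq[OF assms] plane_line_subset_eq[OF assms(2,1,3,6,7,4,5)]])

section \<open>The number of support points on a line\<close>

lemma char_vec_nth [simp]: "char_vec l $ P = (if P \<in> l then 1 else 0)"
  by (simp add: char_vec_def)

lemma plane_code_induct [consumes 1, case_names zero add]:
  assumes "c \<in> plane_code" "h 0"
    and "\<And>k l c. l \<in> plane_lines \<Longrightarrow> h c \<Longrightarrow> h (k *s char_vec l + c)"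
  shows "h c"
  using assms(1) unfolding plane_code_def
  by (induction rule: vec.span_induct_alt) (use assms(2,3) in auto)

lemma plane_code_diff_line:
  assumes "c \<in> plane_code" "l \<in> plane_lines"
  shows "c - k *s char_vec l \<in> plane_code"
  using assms unfolding plane_code_def
  by (intro vec.span_diff vec.span_scale) (auto intro: vec.span_base)

text \<open>A line missing \<open>proj_point e1\<close> has one point at each height
  \<open>y\<close>, with abscissa affine in \<open>y\<close>, so the moment is an
  \<open>i\<close>-th power. A line through \<open>proj_point e1\<close> is either some
  \<open>y = y0\<close>, whose moment is a full power sum times the indicator of \<open>y0\<close>,
  or the line at infinity, which has no affine points.\<close>

lemma line_moment_poly:
  fixes l :: "'a::{field, finite} point set"
  assumes fr: "frame e1 e2 e3 a1 a2 a3" and l: "l \<in> plane_lines"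
  shows "\<exists>P. degree P \<le> i \<and>
    (\<forall>y. poly P y = (\<Sum>x\<in>UNIV. char_vec l $ proj_point (x *s e1 + y *s e2 + e3) * x ^ i))"
proof -
  obtain b where b: "b \<noteq> 0" "has_equation l b"
    by (rule plane_line_has_equation[OF l])
  note nz = frame_affine_nonzero[OF fr]
  define \<alpha> \<beta> \<gamma> where "\<alpha> = pairing b e1" and "\<beta> = pairing b e2" and "\<gamma> = pairing b e3"
  have mem: "proj_point (x *s e1 + y *s e2 + e3) \<in> l \<longleftrightarrow> \<alpha> * x + \<beta> * y + \<gamma> = 0" for x y
    using has_equationD[OF b(2) nz] by (simp add: \<alpha>_def \<beta>_def \<gamma>_def mult.commute)
  have not_all_0: "\<alpha> \<noteq> 0 \<or> \<beta> \<noteq> 0 \<or> \<gamma> \<noteq> 0"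
  proof (rule ccontr)
    assume "\<not> ?thesis"
    then have z: "pairing b e1 = 0" "pairing b e2 = 0" "pairing b e3 = 0"
      by (auto simp: \<alpha>_def \<beta>_def \<gamma>_def)
    have b0: "pairing b u = 0" for u
    proof -
      have "pairing b u = pairing b (pairing a1 u *s e1 + pairing a2 u *s e2 + pairing a3 u *s e3)"
        using frame_expand[OF fr, of u] by (rule arg_cong)
      then show ?thesis
        by (simp add: z)
    qed
    then have "b $ j = 0" for j
      using b0[of "axis j 1"] by (simp only: pairing_axis)
    then show False
      using b(1) by (simp add: Finite_Cartesian_Product.vec_eq_iff)
  qed
  define g where "g y = (\<Sum>x\<in>UNIV. (if \<alpha> * x + \<beta> * y + \<gamma> = 0 then 1 else 0) * x ^ i)" for y
  have "\<exists>P. degree P \<le> i \<and> (\<forall>y. poly P y = g y)"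
  proof (cases "\<alpha> = 0")
    case False
    let ?P = "[:- \<gamma> / \<alpha>, - \<beta> / \<alpha>:] ^ i"
    have "\<alpha> * x + \<beta> * y + \<gamma> = 0 \<longleftrightarrow> x = - \<gamma> / \<alpha> - \<beta> / \<alpha> * y" for x y
    proof -
      have "\<alpha> * x + \<beta> * y + \<gamma> = \<alpha> * (x - (- \<gamma> / \<alpha> - \<beta> / \<alpha> * y))"
        using False by (simp add: field_simps)
      then show ?thesis
        using False by simp
    qed
    then have "poly ?P y = g y" for y
      unfolding g_def by (simp add: poly_power if_distrib[of "\<lambda>z. z * _"] mult.commute[of y] cong: if_cong)
    moreover have "degree ?P \<le> i"
      using degree_power_le[of "[:- \<gamma> / \<alpha>, - \<beta> / \<alpha>:]" i] by (simp split: if_splits)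
    ultimately show ?thesis
      by blast
  next
    case \<alpha>: True
    show ?thesis
    proof (cases "\<beta> = 0")
      case False
      let ?q = "CARD('a) - 1"
      define y0 where "y0 = - \<gamma> / \<beta>"
      define M where "M = (\<Sum>x\<in>UNIV. x ^ i :: 'a)"
      \<comment> \<open>The second factor is the indicator of \<open>y0\<close>. Its degree
        \<open>CARD('a) - 1\<close> is harmless because \<open>M\<close> is 0 for smaller
        \<open>i\<close>.\<close>
      let ?P = "Polynomial.smult M (1 - [:- y0, 1:] ^ ?q)"
      have iff: "\<alpha> * x + \<beta> * y + \<gamma> = 0 \<longleftrightarrow> y = y0" for x y
      proof -
        have "\<alpha> * x + \<beta> * y + \<gamma> = \<beta> * (y - y0)"
          using False \<alpha> by (simp add: y0_def field_simps)
        then show ?thesis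
          using False by simp
      qed
      have "?q \<noteq> 0"
        using card_field_ge_2[where 'a = 'a] by simp
      then have "poly ?P y = g y" for y
        unfolding g_def iff using power_card_minus_1[of "y - y0"]
        by (cases "y = y0") (auto simp: poly_power M_def simp del: One_nat_def)
      moreover have "degree ?P \<le> i"
      proof (cases "i < ?q")
        case True
        then have "M = 0"
          unfolding M_def by (subst sum_power_field) auto
        then show ?thesis by simp
      next
        case False
        have "degree (1 - [:- y0, 1:] ^ ?q) \<le> ?q"
          using degree_power_le[of "[:- y0, 1:]" ?q] by (intro degree_diff_le) auto
        then show ?thesis
          using False degree_smult_le[of M] by (meson le_trans not_le)
      qed
      ultimately show ?thesis
        by blast
    next
      case True
      then have "g y = 0" for y
        using \<alpha> not_all_0 by (simp add: g_def)
      then show ?thesis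
        by (intro exI[of _ 0]) simp
    qed
  qed
  then show ?thesis
    by (simp add: g_def mem)
qed

lemma code_moment_poly:
  fixes c :: "'a::{field, finite} ^ 'a point"
  assumes fr: "frame e1 e2 e3 a1 a2 a3" and "c \<in> plane_code"
  shows "\<exists>P. degree P \<le> i \<and>
    (\<forall>y. poly P y = (\<Sum>x\<in>UNIV. c $ proj_point (x *s e1 + y *s e2 + e3) * x ^ i))"
  using assms(2)
proof (induction rule: plane_code_induct)
  case zero
  then show ?case
    by (intro exI[of _ 0]) simp
next
  case (add k l c)
  obtain P where P: "degree P \<le> i"
    "\<And>y. poly P y = (\<Sum>x\<in>UNIV. c $ proj_point (x *s e1 + y *s e2 + e3) * x ^ i)"
    using add.IH by blast
  obtain Q where Q: "degree Q \<le> i"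
    "\<And>y. poly Q y = (\<Sum>x\<in>UNIV. char_vec l $ proj_point (x *s e1 + y *s e2 + e3) * x ^ i)"
    using line_moment_poly[OF fr add.hyps] by blast
  have "degree (Polynomial.smult k Q + P) \<le> i"
    using P(1) Q(1) degree_smult_le[of k Q] by (intro degree_add_le) auto
  moreover have "poly (Polynomial.smult k Q + P) y =
      (\<Sum>x\<in>UNIV. (k *s char_vec l + c) $ proj_point (x *s e1 + y *s e2 + e3) * x ^ i)" for y
    by (simp only: poly_add poly_smult P(2) Q(2) vector_add_component vector_smult_component
        distrib_right sum.distrib sum_distrib_left mult.assoc)
  ultimately show ?case
    by blast
qed

text \<open>The point \<open>N\<close> becomes the point \<open>proj_point e1\<close> and
  \<open>l\<close> the line \<open>y = 0\<close>; the root count then concerns the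
  \<open>CARD('a)\<close> lines \<open>y = const\<close> through \<open>N\<close>. The inequality is
  \<open>s * (CARD('a) + 1 - s) \<le> wt c\<close>, written without a difference that could be
  truncated unfavourably.\<close>

lemma line_weight_bound:
  fixes c :: "'a::{field, finite} ^ 'a point"
  assumes c: "c \<in> plane_code" and l: "l \<in> plane_lines" and N: "N \<in> l"
    and s: "s = card (l \<inter> supp c - {N})"
  shows "s * CARD('a) \<le> wt c + s * (s - 1)"
proof -
  obtain e1 where e1: "e1 \<noteq> 0" "N = proj_point e1"
    by (rule proj_point_cases)
  obtain e2 e3 a1 a2 a3 where fr: "frame e1 e2 e3 a1 a2 a3" and eq: "has_equation l a2"
    using plane_line_equation[OF l e1(1)] e1(2) N by blast
  note p = plane_line_param[OF fr eq]
  define F where "F x y = c $ proj_point (x *s e1 + y *s e2 + e3)" for x y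
  have "\<forall>i. \<exists>P. degree P \<le> i \<and> (\<forall>y. poly P y = (\<Sum>x\<in>UNIV. F x y * x ^ i))"
    using code_moment_poly[OF fr c] unfolding F_def by blast
  from choice[OF this] obtain P where P: "\<And>i. degree (P i) \<le> i"
      "\<And>i y. poly (P i) y = (\<Sum>x\<in>UNIV. F x y * x ^ i)"
    by auto
  have "l \<inter> supp c - {N} = (l - {N}) \<inter> supp c"
    by blast
  also have "\<dots> = (\<lambda>x. proj_point (x *s e1 + e3)) ` {x. F x 0 \<noteq> 0}"
    unfolding e1(2) p(1) by (auto simp: F_def supp_def)
  finally have "s = card {x. F x 0 \<noteq> 0}"
    by (simp add: s card_image[OF inj_on_subset[OF p(2) subset_UNIV]])
  then have count: "(\<Sum>y\<in>UNIV. s - card {x. F x y \<noteq> 0}) \<le> s * (s - 1)"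
    by (rule hankel_count[OF P])
  let ?A = "SIGMA y:UNIV. {x. F x y \<noteq> 0}"
  let ?pt = "\<lambda>(y, x). proj_point (x *s e1 + y *s e2 + e3)"
  note nz = frame_affine_nonzero[OF fr]
  have "inj ?pt"
  proof (rule injI, clarify)
    fix y x y' x' assume "proj_point (x *s e1 + y *s e2 + e3) = proj_point (x' *s e1 + y' *s e2 + e3)"
    then obtain k where k: "x *s e1 + y *s e2 + e3 = k *s (x' *s e1 + y' *s e2 + e3)"
      using proj_point_eq_iff[OF nz nz] by blast
    have "k = 1"
      using arg_cong[OF k, of "pairing a3"] by (simp add: frame_pairing[OF fr])
    then show "y = y' \<and> x = x'"
      using arg_cong[OF k, of "pairing a1"] arg_cong[OF k, of "pairing a2"]
      by (simp add: frame_pairing[OF fr])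
  qed
  then have "card ?A = card (?pt ` ?A)"
    by (intro card_image[symmetric]) (rule inj_on_subset[OF _ subset_UNIV])
  also have "\<dots> \<le> wt c"
    unfolding wt_def by (intro card_mono) (auto simp: supp_def F_def)
  finally have "(\<Sum>y\<in>UNIV. card {x. F x y \<noteq> 0}) \<le> wt c"
    by simp
  \<comment> \<open>With truncated subtraction only an inequality holds, in the direction that is
    needed.\<close>
  moreover have "(\<Sum>y\<in>(UNIV :: 'a set). s) \<le>
      (\<Sum>y\<in>UNIV. (s - card {x. F x y \<noteq> 0}) + card {x. F x y \<noteq> 0})"
    by (intro sum_mono) simp
  ultimately show ?thesis
    using count by (simp add: sum.distrib mult.commute)
qed

section \<open>Counting points and lines\<close>

lemma point_off_line:
  assumes "l \<in> plane_lines"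
  obtains P where "P \<notin> l"
proof -
  obtain u where u: "u \<noteq> 0" "proj_point u \<in> l"
    by (rule plane_line_nonempty[OF assms])
  obtain e2 e3 a1 a2 a3 where fr: "frame u e2 e3 a1 a2 a3" and eq: "has_equation l a2"
    using plane_line_equation[OF assms u] by blast
  show ?thesis
    using that[of "proj_point e2"] has_equationD[OF eq frame_nonzero(2)[OF fr]]
    by (simp add: frame_pairing[OF fr])
qed

lemma other_line_through:
  assumes "l \<in> plane_lines" "P \<in> l"
  obtains m where "m \<in> plane_lines" "P \<in> m" "m \<noteq> l"
proof -
  obtain Q where Q: "Q \<notin> l"
    by (rule point_off_line[OF assms(1)])
  then have "P \<noteq> Q"
    using assms(2) by blast
  then obtain m where "m \<in> plane_lines" "P \<in> m" "Q \<in> m"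
    by (rule plane_line_through)
  then show ?thesis
    using that Q by blast
qed

lemma point_on_line_avoiding:
  fixes l :: "'a::{field, finite} point set"
  assumes "l \<in> plane_lines" "card A \<le> CARD('a)"
  obtains Q where "Q \<in> l" "Q \<notin> A"
proof -
  have "\<not> l \<subseteq> A"
    using card_mono[of A l] card_plane_line[OF assms(1)] assms(2) by fastforce
  then show ?thesis
    using that by blast
qed

lemma line_through_exists:
  fixes P :: "'a::field point"
  obtains l where "l \<in> plane_lines" "P \<in> l"
proof -
  let ?e = "axis 1 1 :: 'a ^ 3" and ?f = "axis 2 1 :: 'a ^ 3"
  have nz: "?e \<noteq> 0" "?f \<noteq> 0"
    by (auto simp: axis_eq_0_iff)
  have "proj_point ?e \<noteq> proj_point ?f"
  proof
    assume "proj_point ?e = proj_point ?f"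
    then obtain k where k: "?e = k *s ?f"
      unfolding proj_point_eq_iff[OF nz] by blast
    show False
      using arg_cong[OF k, of "\<lambda>u. u $ 1"] by (simp add: axis_def)
  qed
  then have "\<exists>Q. P \<noteq> Q"
    by metis
  then obtain Q where Q: "P \<noteq> Q"
    by blast
  show ?thesis
    by (rule plane_line_through[OF Q]) (rule that)
qed

lemma ex_line_through_two_points: "\<exists>l. l \<in> plane_lines \<and> P \<in> l \<and> Q \<in> l"
proof (cases "P = Q")
  case True
  then show ?thesis
    using line_through_exists[of P] by blast
next
  case False
  then show ?thesis
    by (rule plane_line_through) blast
qed

lemma line_avoiding:
  fixes P :: "'a::{field, finite} point"
  obtains m where "m \<in> plane_lines" "P \<notin> m"
proof -
  obtain l where l: "l \<in> plane_lines" "P \<in> l"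
    by (rule line_through_exists)
  obtain R where R: "R \<in> l" "R \<notin> {P}"
    by (rule point_on_line_avoiding[OF l(1), of "{P}"]) auto
  obtain m where m: "m \<in> plane_lines" "R \<in> m" "m \<noteq> l"
    by (rule other_line_through[OF l(1) R(1)])
  have "P \<notin> m"
    using plane_lines_eqI[OF m(1) l(1), of R P] R l m by auto
  then show ?thesis
    using that m(1) by blast
qed

text \<open>Joining \<open>P\<close> to the points of a line missing \<open>P\<close> gives distinct
  lines. This guarantees enough lines to fill up a cover of the support to exactly four.\<close>

lemma card_plane_lines_ge: "CARD('a) + 1 \<le> card (plane_lines :: 'a::{field, finite} point set set)"
proof -
  obtain P :: "'a point" where True
    by blast
  obtain m where m: "m \<in> plane_lines" "P \<notin> m"
    by (rule line_avoiding)
  have "\<forall>Z. \<exists>l. l \<in> plane_lines \<and> P \<in> l \<and> Z \<in> l"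
    using ex_line_through_two_points by blast
  from choice[OF this] obtain f where f: "f Z \<in> plane_lines \<and> P \<in> f Z \<and> Z \<in> f Z" for Z
    by blast
  have "inj_on f m"
  proof (rule inj_onI, rule ccontr)
    fix Y Z assume YZ: "Y \<in> m" "Z \<in> m" "f Y = f Z" "Y \<noteq> Z"
    then have "f Y = m"
      using f[of Y] f[of Z] by (intro plane_lines_eqI[OF _ m(1) YZ(4)]) auto
    then show False
      using f[of Y] m(2) by simp
  qed
  then have "card m \<le> card (plane_lines :: 'a point set set)"
    using f by (intro card_inj_on_le[of f]) auto
  then show ?thesis
    by (simp add: card_plane_line[OF m(1)])
qed

lemma card_inter_plane_lines:
  assumes "l \<in> plane_lines" "m \<in> plane_lines" "l \<noteq> m"
  shows "card (l \<inter> m) \<le> 1"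
proof (cases "l \<inter> m = {}")
  case False
  then obtain P where P: "P \<in> l" "P \<in> m"
    by blast
  have "l \<inter> m = {P}"
    using plane_lines_eqI[OF assms(1,2), of _ P] P assms(3) by blast
  then show ?thesis
    by simp
qed simp

text \<open>The lines through \<open>P\<close> are its joins with the points of a fixed line
  \<open>m\<close> missing \<open>P\<close>; each carries at most \<open>t\<close> points of
  \<open>S\<close> besides \<open>P\<close>.\<close>

lemma card_pencil_bound:
  fixes S :: "'a::{field, finite} point set"
  assumes P: "P \<in> S" and bound: "\<And>l. l \<in> plane_lines \<Longrightarrow> P \<in> l \<Longrightarrow> card (l \<inter> S) \<le> Suc t"
  shows "card S \<le> 1 + t * (CARD('a) + 1)"
proof -
  obtain m where m: "m \<in> plane_lines" "P \<notin> m"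
    by (rule line_avoiding)
  have "\<forall>Z. \<exists>l. l \<in> plane_lines \<and> P \<in> l \<and> Z \<in> l"
    using ex_line_through_two_points by blast
  from choice[OF this] obtain f where f: "f Z \<in> plane_lines \<and> P \<in> f Z \<and> Z \<in> f Z" for Z
    by blast
  have "S - {P} \<subseteq> (\<Union>Z\<in>m. f Z \<inter> S - {P})"
  proof
    fix X assume X: "X \<in> S - {P}"
    then have "P \<noteq> X"
      by blast
    then obtain l where l: "l \<in> plane_lines" "P \<in> l" "X \<in> l"
      by (rule plane_line_through)
    obtain Z where Z: "Z \<in> l" "Z \<in> m"
      using plane_lines_meet[OF l(1) m(1)] by blast
    then have "P \<noteq> Z"
      using m(2) by blast
    then have "l = f Z"
      using f[of Z] l Z by (intro plane_lines_eqI[of l "f Z" P Z]) auto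
    then show "X \<in> (\<Union>Z\<in>m. f Z \<inter> S - {P})"
      using l X Z by blast
  qed
  then have "card (S - {P}) \<le> card (\<Union>Z\<in>m. f Z \<inter> S - {P})"
    by (intro card_mono) auto
  also have "\<dots> \<le> (\<Sum>Z\<in>m. card (f Z \<inter> S - {P}))"
    by (rule card_UN_le) simp
  also have "\<dots> \<le> (\<Sum>Z\<in>m. t)"
  proof (rule sum_mono)
    fix Z assume "Z \<in> m"
    then have "card (f Z \<inter> S) \<le> Suc t" "P \<in> f Z \<inter> S"
      using f bound P by auto
    then show "card (f Z \<inter> S - {P}) \<le> t"
      by (simp add: card_Diff_singleton)
  qed
  also have "\<dots> = t * (CARD('a) + 1)"
    by (simp add: card_plane_line[OF m(1)] mult.commute)
  finally show ?thesis
    using card_Suc_Diff1[of S P] P by simp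
qed

text \<open>Lines are added one at a time. A new line shares at most one point with each earlier
  one, so at most one point is lost per pair.\<close>

lemma card_union_lines_bound:
  fixes S :: "'a::{field, finite} point set"
  assumes "K \<subseteq> plane_lines" "\<And>l. l \<in> K \<Longrightarrow> m \<le> card (l \<inter> S)"
  shows "card K * m \<le> card (S \<inter> \<Union>K) + (card K choose 2)"
  using finite[of K] assms
proof (induction K rule: finite_induct)
  case (insert l K)
  have "card (l \<inter> S \<inter> (S \<inter> \<Union>K)) \<le> card (\<Union>k\<in>K. l \<inter> k)"
    by (intro card_mono) auto
  also have "\<dots> \<le> (\<Sum>k\<in>K. card (l \<inter> k))"
    by (rule card_UN_le) simp
  also have "\<dots> \<le> (\<Sum>k\<in>K. 1)"
    using insert.hyps insert.prems(1) by (intro sum_mono card_inter_plane_lines) auto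
  finally have "card (l \<inter> S \<inter> (S \<inter> \<Union>K)) \<le> card K"
    by simp
  moreover have "card (l \<inter> S) + card (S \<inter> \<Union>K) =
      card (l \<inter> S \<union> S \<inter> \<Union>K) + card (l \<inter> S \<inter> (S \<inter> \<Union>K))"
    by (rule card_Un_Int) auto
  moreover have "l \<inter> S \<union> S \<inter> \<Union>K = S \<inter> \<Union>(insert l K)"
    by blast
  moreover have "m \<le> card (l \<inter> S)" "card K * m \<le> card (S \<inter> \<Union>K) + (card K choose 2)"
    using insert.prems insert.IH by auto
  moreover have "Suc (card K) choose 2 = card K + (card K choose 2)"
    using binomial_Suc_Suc[of "card K" 1] by (simp add: numeral_2_eq_2)
  ultimately show ?case
    using insert.hyps by simp
qed simp

section \<open>Intersections of lines with the support\<close>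

lemma line_supp_bound:
  fixes c :: "'a::{field, finite} ^ 'a point"
  assumes "c \<in> plane_code" "l \<in> plane_lines" "card (l \<inter> supp c) \<le> CARD('a)"
  defines "s \<equiv> card (l \<inter> supp c)"
  shows "s * CARD('a) \<le> wt c + s * (s - 1)"
proof -
  obtain N where "N \<in> l" "N \<notin> l \<inter> supp c"
    by (rule point_on_line_avoiding[OF assms(2,3)])
  then show ?thesis
    using line_weight_bound[OF assms(1,2) _ refl, of N] by (simp add: s_def)
qed

text \<open>For \<open>t\<close> support points on \<open>l\<close>, the lower bound
  \<open>t * (CARD('a) + 1 - t)\<close> for the weight is concave in \<open>t\<close> and equals
  \<open>5 * CARD('a) - 20\<close> at both \<open>t = 5\<close> and \<open>t = CARD('a) - 4\<close>,
  which is more than the weight allowed.\<close>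

lemma line_dichotomy:
  fixes c :: "'a::{field, finite} ^ 'a point"
  assumes "c \<in> plane_code" "l \<in> plane_lines" "wt c + 26 \<le> 5 * CARD('a)"
    and t: "5 \<le> card (l \<inter> supp c)"
  shows "CARD('a) \<le> card (l \<inter> supp c) + 3"
proof (rule ccontr)
  let ?t = "card (l \<inter> supp c)"
  assume "\<not> ?thesis"
  \<comment> \<open>The slack variables \<open>a\<close> and \<open>b\<close> eliminate all
    differences: what remains is \<open>(5 + a) * (5 + b) \<le> 19 + 5 * a + 5 * b\<close>, which is
    absurd.\<close>
  then obtain b where b: "CARD('a) = ?t + 4 + b"
    using le_iff_add[of "?t + 4" "CARD('a)"] by auto
  obtain a where a: "?t = 5 + a"
    using t le_iff_add[of 5 ?t] by auto
  have "?t * CARD('a) \<le> wt c + ?t * (?t - 1)"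
    by (rule line_supp_bound[OF assms(1,2)]) (use b in simp)
  then have "(5 + a) * (9 + a + b) \<le> wt c + (5 + a) * (4 + a)"
    unfolding b unfolding a by (simp add: add_ac)
  moreover have "wt c + 26 \<le> 5 * (9 + a + b)"
    using assms(3) unfolding b unfolding a by simp
  ultimately show False
    by (simp add: algebra_simps)
qed

text \<open>Descent on \<open>t\<close>. If \<open>P\<close> is in the support and a line through it
  has exactly \<open>Suc t\<close> support points, the lower bound from that line and the upper
  bound from the pencil of \<open>P\<close> combine to
  \<open>CARD('a) \<le> (Suc t)\<^sup>2\<close>. So \<open>Suc t\<close> can be replaced by
  \<open>t\<close>, down to 0.\<close>

lemma light_pencil_not_in_supp:
  fixes c :: "'a::{field, finite} ^ 'a point"
  assumes "c \<in> plane_code" "t\<^sup>2 < CARD('a)"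
    and "\<And>l. l \<in> plane_lines \<Longrightarrow> P \<in> l \<Longrightarrow> card (l \<inter> supp c) \<le> t"
  shows "P \<notin> supp c"
  using assms(2,3)
proof (induction t)
  case 0
  obtain l where l: "l \<in> plane_lines" "P \<in> l"
    by (rule line_through_exists)
  then show ?case
    using "0.prems"(2)[of l] by auto
next
  case (Suc t)
  show ?case
  proof
    assume P: "P \<in> supp c"
    have wt: "wt c \<le> 1 + t * (CARD('a) + 1)"
      unfolding wt_def by (rule card_pencil_bound[OF P Suc.prems(2)])
    have "card (l \<inter> supp c) \<le> t" if l: "l \<in> plane_lines" "P \<in> l" for l
    proof (rule ccontr)
      assume "\<not> ?thesis"
      then have s: "card (l \<inter> supp c) = Suc t"
        using Suc.prems(2)[OF l] by simp
      have "Suc t \<le> (Suc t)\<^sup>2"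
        by (simp add: power2_eq_square)
      then have "card (l \<inter> supp c) \<le> CARD('a)"
        using s Suc.prems(1) by simp
      then have "Suc t * CARD('a) \<le> wt c + Suc t * t"
        using line_supp_bound[OF assms(1) l(1)] s by simp
      then show False
        using wt Suc.prems(1) by (simp add: power2_eq_square algebra_simps)
    qed
    moreover have "t\<^sup>2 < CARD('a)"
      by (rule le_less_trans[OF power_mono Suc.prems(1)]) auto
    ultimately have "P \<notin> supp c"
      using Suc.IH by blast
    then show False
      using P by simp
  qed
qed

lemma supp_covered_by_four_lines:
  fixes c :: "'a::{field, finite} ^ 'a point"
  assumes c: "c \<in> plane_code" and wt: "wt c + 26 \<le> 5 * CARD('a)" and q: "17 \<le> CARD('a)"
  obtains L where "L \<subseteq> plane_lines" "card L = 4" "supp c \<subseteq> \<Union>L"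
proof -
  define K where "K = {l \<in> plane_lines. 5 \<le> card (l \<inter> supp c)}"
  have K: "K \<subseteq> plane_lines" "\<And>l. l \<in> K \<Longrightarrow> CARD('a) - 3 \<le> card (l \<inter> supp c)"
    using line_dichotomy[OF c _ wt] by (auto simp: K_def le_diff_conv)
  have "card K \<le> 4"
  proof (rule ccontr)
    assume "\<not> ?thesis"
    then obtain K' where K': "K' \<subseteq> K" "card K' = 5"
      using obtain_subset_with_card_n[of 5 K] by auto
    \<comment> \<open>Five heavy lines would carry at least \<open>5 * (CARD('a) - 3) - 10\<close>
      support points, one more than the weight bound admits.\<close>
    have "card K' * (CARD('a) - 3) \<le> card (supp c \<inter> \<Union>K') + (card K' choose 2)"
      by (rule card_union_lines_bound) (use K K' in auto)
    moreover have "card (supp c \<inter> \<Union>K') \<le> wt c"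
      unfolding wt_def by (intro card_mono) auto
    moreover have "(5::nat) choose 2 = 10"
      by (simp add: choose_two)
    ultimately show False
      using K'(2) wt q by simp
  qed
  \<comment> \<open>The heavy lines are filled up with arbitrary ones, so that the later case
    analysis starts from exactly four lines.\<close>
  moreover have "4 \<le> card (plane_lines :: 'a point set set)"
    using card_plane_lines_ge[where 'a = 'a] q by simp
  ultimately have "\<exists>L. K \<subseteq> L \<and> L \<subseteq> plane_lines \<and> card L = 4"
    by (rule exists_subset_between) (use K(1) in simp_all)
  then obtain L where L: "K \<subseteq> L" "L \<subseteq> plane_lines" "card L = 4"
    by blast
  have "P \<in> \<Union>K" if "P \<in> supp c" for P
  proof (rule ccontr)
    assume P: "P \<notin> \<Union>K"
    have light: "card (l \<inter> supp c) \<le> 4" if "l \<in> plane_lines" "P \<in> l" for l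
    proof (rule ccontr)
      assume "\<not> ?thesis"
      then have "l \<in> K"
        using that(1) by (simp add: K_def)
      then show False
        using P that(2) by blast
    qed
    \<comment> \<open>The descent starts at \<open>t = 4\<close> and so needs
      \<open>16 < CARD('a)\<close>.\<close>
    have "P \<notin> supp c"
      by (rule light_pencil_not_in_supp[OF c _ light]) (use q in simp_all)
    then show False
      using that by simp
  qed
  then have "supp c \<subseteq> \<Union>L"
    using Union_mono[OF L(1)] by blast
  then show ?thesis
    by (rule that[OF L(2,3)])
qed

section \<open>Orthogonality and codewords supported on few lines\<close>

definition point_rep :: "'a::field point \<Rightarrow> 'a ^ 3" where
  "point_rep P = (SOME u. u \<noteq> 0 \<and> P = proj_point u)"

lemma point_rep: "point_rep P \<noteq> 0" "proj_point (point_rep P) = P"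
proof -
  obtain u where "u \<noteq> 0" "P = proj_point u"
    by (rule proj_point_cases)
  then have "\<exists>u. u \<noteq> 0 \<and> P = proj_point u"
    by blast
  from someI_ex[OF this] have "point_rep P \<noteq> 0 \<and> P = proj_point (point_rep P)"
    unfolding point_rep_def .
  then show "point_rep P \<noteq> 0" "proj_point (point_rep P) = P"
    by auto
qed

text \<open>A product of \<open>q - 1\<close> linear forms is a well-defined function on points, because
  \<open>k ^ (q - 1) = 1\<close> for nonzero \<open>k\<close>.\<close>

definition form_product :: "(nat \<Rightarrow> 'a ^ 3) \<Rightarrow> 'a::{field, finite} point \<Rightarrow> 'a" where
  "form_product a P = (\<Prod>j<CARD('a) - 1. pairing (a j) (point_rep P))"

lemma form_product_proj_point:
  fixes u :: "'a::{field, finite} ^ 3"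
  assumes "u \<noteq> 0"
  shows "form_product a (proj_point u) = (\<Prod>j<CARD('a) - 1. pairing (a j) u)"
proof -
  have "proj_point (point_rep (proj_point u)) = proj_point u"
    by (rule point_rep(2))
  then obtain k where k: "k \<noteq> 0" "point_rep (proj_point u) = k *s u"
    unfolding proj_point_eq_iff[OF point_rep(1) assms] by blast
  then have "form_product a (proj_point u) = k ^ (CARD('a) - 1) * (\<Prod>j<CARD('a) - 1. pairing (a j) u)"
    by (simp add: form_product_def prod.distrib)
  then show ?thesis
    by (simp add: power_card_minus_1[OF k(1)] del: One_nat_def)
qed

text \<open>On the affine part of \<open>l\<close> the product is a polynomial of degree at most
  \<open>CARD('a) - 1\<close> in the parameter. Its sum over the field is minus the coefficient at
  \<open>CARD('a) - 1\<close>, and that coefficient is the value of the product at the remaining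
  point \<open>proj_point e1\<close>.\<close>

lemma form_product_line_sum:
  fixes l :: "'a::{field, finite} point set"
  assumes "l \<in> plane_lines"
  shows "(\<Sum>P\<in>l. form_product a P) = 0"
proof -
  obtain e1 where e1: "e1 \<noteq> 0" "proj_point e1 \<in> l"
    by (rule plane_line_nonempty[OF assms])
  obtain e2 e3 a1 a2 a3 where fr: "frame e1 e2 e3 a1 a2 a3" and eq: "has_equation l a2"
    using plane_line_equation[OF assms e1] by blast
  note p = plane_line_param[OF fr eq]
  let ?n = "CARD('a) - 1"
  let ?Q = "\<Prod>j<?n. [:pairing (a j) e3, pairing (a j) e1:]"
  have "(\<Sum>P\<in>l. form_product a P) =
      form_product a (proj_point e1) + (\<Sum>P\<in>l - {proj_point e1}. form_product a P)"
    by (subst sum.remove[of l "proj_point e1"]) (use e1(2) in auto)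
  also have "form_product a (proj_point e1) = (\<Prod>j<?n. pairing (a j) e1)"
    by (rule form_product_proj_point[OF e1(1)])
  also have "(\<Sum>P\<in>l - {proj_point e1}. form_product a P) =
      (\<Sum>x\<in>UNIV. form_product a (proj_point (x *s e1 + e3)))"
    unfolding p(1) by (subst sum.reindex[OF p(2)]) (simp add: o_def)
  also have "\<dots> = (\<Sum>x\<in>UNIV. poly ?Q x)"
    unfolding form_product_proj_point[OF p(4)] by (simp add: poly_prod add.commute)
  also have "\<dots> = - coeff ?Q ?n"
    by (rule sum_poly_field) (rule coeff_prod_linear[THEN conjunct1])
  also have "coeff ?Q ?n = (\<Prod>j<?n. pairing (a j) e1)"
    by (rule coeff_prod_linear[THEN conjunct2])
  finally show ?thesis
    by simp
qed

lemma form_product_orthogonal: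
  fixes c :: "'a::{field, finite} ^ 'a point"
  assumes "c \<in> plane_code"
  shows "(\<Sum>P\<in>UNIV. c $ P * form_product a P) = 0"
  using assms
proof (induction rule: plane_code_induct)
  case (add k l c)
  have "(\<Sum>P\<in>UNIV. char_vec l $ P * form_product a P) = (\<Sum>P\<in>l. form_product a P)"
    by (rule sum.mono_neutral_cong_right) auto
  then have "(\<Sum>P\<in>UNIV. char_vec l $ P * form_product a P) = 0"
    by (simp add: form_product_line_sum[OF add.hyps])
  then have "(\<Sum>P\<in>UNIV. k * (char_vec l $ P * form_product a P)) = 0"
    by (simp add: sum_distrib_left[symmetric] del: char_vec_nth)
  then show ?case
    using add.IH by (simp add: distrib_right sum.distrib mult.assoc del: char_vec_nth)
qed simp

text \<open>The number of factors is fixed at \<open>CARD('a) - 1\<close>; if \<open>M\<close> has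
  fewer lines, one of them is repeated, which leaves the zero set unchanged.\<close>

lemma form_product_vanishing_exactly:
  fixes M :: "'a::{field, finite} point set set"
  assumes "M \<subseteq> plane_lines" "M \<noteq> {}" "card M \<le> CARD('a) - 1"
  obtains a :: "nat \<Rightarrow> 'a ^ 3" where "\<forall>P. form_product a P = 0 \<longleftrightarrow> P \<in> \<Union>M"
proof -
  have "\<forall>m\<in>M. \<exists>b. has_equation m b"
  proof
    fix m assume "m \<in> M"
    then have "m \<in> plane_lines"
      using assms(1) by blast
    then obtain b where "has_equation m b"
      by (rule plane_line_has_equation)
    then show "\<exists>b. has_equation m b"
      by blast
  qed
  from bchoice[OF this] obtain eqn where eqn: "has_equation m (eqn m)" if "m \<in> M" for m
    by blast
  obtain h where h: "bij_betw h {0..<card M} M"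
    using ex_bij_betw_nat_finite[of M] by auto
  define g where "g j = h (if j < card M then j else 0)" for j
  have "card M > 0"
    using assms(2) by (simp add: card_gt_0_iff)
  have "(\<lambda>j. if j < card M then j else 0) ` {..<CARD('a) - 1} = {0..<card M}"
  proof (rule subset_antisym; rule subsetI)
    fix i assume "i \<in> (\<lambda>j. if j < card M then j else 0) ` {..<CARD('a) - 1}"
    then show "i \<in> {0..<card M}"
      using \<open>card M > 0\<close> by (auto split: if_splits)
  next
    fix i assume "i \<in> {0..<card M}"
    then show "i \<in> (\<lambda>j. if j < card M then j else 0) ` {..<CARD('a) - 1}"
      using assms(3) by (intro image_eqI[of _ _ i]) simp_all
  qed
  moreover have "g = h \<circ> (\<lambda>j. if j < card M then j else 0)"
    by (simp add: fun_eq_iff g_def)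
  ultimately have g_image: "g ` {..<CARD('a) - 1} = M"
    using bij_betw_imp_surj_on[OF h] by (simp only: image_comp[symmetric])
  have g: "g j \<in> M" if "j < CARD('a) - 1" for j
    unfolding g_image[symmetric] by (rule imageI) (use that in simp)
  have "form_product (\<lambda>j. eqn (g j)) P = 0 \<longleftrightarrow> P \<in> \<Union>M" for P
  proof -
    have "pairing (eqn m) (point_rep P) = 0 \<longleftrightarrow> P \<in> m" if "m \<in> M" for m
      using has_equationD[OF eqn[OF that] point_rep(1)[of P]] by (simp add: point_rep(2))
    then have "form_product (\<lambda>j. eqn (g j)) P = 0 \<longleftrightarrow> (\<exists>j\<in>{..<CARD('a) - 1}. P \<in> g j)"
      using g by (auto simp: form_product_def)
    also have "\<dots> \<longleftrightarrow> P \<in> \<Union>(g ` {..<CARD('a) - 1})"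
      by blast
    finally show ?thesis
      by (simp only: g_image)
  qed
  then show ?thesis
    by (intro that) blast
qed

text \<open>If \<open>q - 1\<close> lines cover the support except for two points of \<open>l\<close>, orthogonality to the product of
  their equations relates the values of \<open>c\<close> at these two points, in the same way as for \<open>char_vec l\<close>.\<close>

lemma constant_off_lines:
  fixes c :: "'a::{field, finite} ^ 'a point"
  assumes c: "c \<in> plane_code" and l: "l \<in> plane_lines" and L: "L \<subseteq> plane_lines"
    and supp: "supp c \<subseteq> l \<union> \<Union>L"
    and disj: "\<And>m m'. m \<in> L \<Longrightarrow> m' \<in> L \<Longrightarrow> m \<noteq> m' \<Longrightarrow> l \<inter> m \<inter> m' = {}"
    and A: "A \<in> l - \<Union>L" and B: "B \<in> l - \<Union>L"
  shows "c $ A = c $ B"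
proof (cases "A = B")
  case False
  \<comment> \<open>Each of these remaining points of \<open>l\<close> will be covered by a line of
    its own, different from \<open>l\<close>.\<close>
  define Z where "Z = l - \<Union>L - {A, B}"
  have "\<forall>z\<in>l. \<exists>m. m \<in> plane_lines \<and> z \<in> m \<and> m \<noteq> l"
    using other_line_through[OF l] by metis
  from bchoice[OF this] obtain f where f: "f z \<in> plane_lines \<and> z \<in> f z \<and> f z \<noteq> l" if "z \<in> l" for z
    by blast
  define M where "M = L \<union> f ` Z"
  have M_lines: "M \<subseteq> plane_lines"
    using L f by (auto simp: M_def Z_def)
  have "\<forall>m\<in>L. \<exists>P. P \<in> l \<inter> m"
    using plane_lines_meet[OF l] L by blast
  from bchoice[OF this] obtain g where g: "g m \<in> l \<inter> m" if "m \<in> L" for m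
    by blast
  \<comment> \<open>By \<open>disj\<close> the lines of \<open>L\<close> meet \<open>l\<close> in
    distinct points, so \<open>card L + card Z\<close> is at most the number
    \<open>CARD('a) - 1\<close> of points of \<open>l\<close> other than \<open>A\<close> and
    \<open>B\<close>.\<close>
  have "inj_on g L"
  proof (rule inj_onI, rule ccontr)
    fix m m' assume m: "m \<in> L" "m' \<in> L" "g m = g m'" "m \<noteq> m'"
    then have "g m \<in> l \<inter> m \<inter> m'"
      using g[OF m(1)] g[OF m(2)] by simp
    then show False
      using disj[OF m(1,2,4)] by simp
  qed
  then have "card L = card (g ` L)"
    by (simp add: card_image)
  also have "\<dots> \<le> card (l \<inter> \<Union>L)"
    using g by (intro card_mono) auto
  finally have "card L + card Z \<le> card (l \<inter> \<Union>L) + card Z"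
    by simp
  also have "\<dots> = card (l \<inter> \<Union>L \<union> Z)"
    by (rule card_Un_disjoint[symmetric]) (auto simp: Z_def)
  also have "l \<inter> \<Union>L \<union> Z = l - {A, B}"
    using A B by (auto simp: Z_def)
  also have "card \<dots> = CARD('a) - 1"
    using A B False by (simp add: card_Diff_subset card_plane_line[OF l])
  finally have "card L + card Z \<le> CARD('a) - 1" .
  then have M_card: "card M \<le> CARD('a) - 1"
    using card_Un_le[of L "f ` Z"] card_image_le[of Z f] by (simp add: M_def)
  have cover: "P \<in> \<Union>M" if "P \<in> l" "P \<noteq> A" "P \<noteq> B" for P
    using that f[OF that(1)] by (cases "P \<in> \<Union>L") (auto simp: M_def Z_def)
  have "card {A, B} \<le> CARD('a)"
    using card_field_ge_2[where 'a = 'a] False by simp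
  then obtain D where "D \<in> l" "D \<notin> {A, B}"
    by (rule point_on_line_avoiding[OF l])
  then have "M \<noteq> {}"
    using cover by blast
  obtain a :: "nat \<Rightarrow> 'a ^ 3" where a: "\<forall>P. form_product a P = 0 \<longleftrightarrow> P \<in> \<Union>M"
    by (rule form_product_vanishing_exactly[OF M_lines \<open>M \<noteq> {}\<close> M_card])
  have avoid: "B \<notin> \<Union>M"
  proof
    assume "B \<in> \<Union>M"
    then obtain z where z: "z \<in> Z" "B \<in> f z"
      using B by (auto simp: M_def)
    then have "f z = l"
      using f[of z] B by (intro plane_lines_eqI[OF _ l, of _ z B]) (auto simp: Z_def)
    then show False
      using f[of z] z by (simp add: Z_def)
  qed
  \<comment> \<open>This codeword vanishes at \<open>A\<close>, and the product vanishes on the rest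
    of its support except possibly at \<open>B\<close>; orthogonality then leaves a single
    term.\<close>
  let ?c = "c - (c $ A) *s char_vec l"
  have "?c $ P * form_product a P = 0" if "P \<noteq> B" for P
  proof (cases "P \<in> \<Union>M")
    case True
    then show ?thesis
      using a by simp
  next
    case False
    then have "P \<notin> \<Union>L" "P \<in> l \<longrightarrow> P = A"
      using cover[of P] that by (auto simp: M_def)
    moreover have "c $ P = 0 \<or> P \<in> l \<union> \<Union>L"
      using supp by (auto simp: supp_def)
    ultimately show ?thesis
      using A by auto
  qed
  then have "(\<Sum>P\<in>UNIV. ?c $ P * form_product a P) = ?c $ B * form_product a B"
    by (subst sum.remove[of _ B]) (simp_all add: sum.neutral)
  then have "?c $ B * form_product a B = 0"
    using form_product_orthogonal[OF plane_code_diff_line[OF c l]] by metis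
  then have "?c $ B = 0"
    using a avoid by simp
  then show ?thesis
    using B by simp
qed simp

section \<open>Splitting off lines from a codeword\<close>

lemma subtract_line:
  fixes c :: "'a::{field, finite} ^ 'a point"
  assumes "c \<in> plane_code" "l \<in> plane_lines" "L \<subseteq> plane_lines" "supp c \<subseteq> l \<union> \<Union>L"
    "\<And>m m'. m \<in> L \<Longrightarrow> m' \<in> L \<Longrightarrow> m \<noteq> m' \<Longrightarrow> l \<inter> m \<inter> m' = {}"
  obtains k where "supp (c - k *s char_vec l) \<subseteq> \<Union>L"
proof (cases "l \<subseteq> \<Union>L")
  case True
  then show ?thesis
    using assms(4) by (intro that[of 0]) auto
next
  case False
  then obtain A where A: "A \<in> l - \<Union>L"
    by blast
  have "c $ B = c $ A" if "B \<in> l - \<Union>L" for B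
    by (rule constant_off_lines[OF assms that A])
  then show ?thesis
    using assms(4) by (intro that[of "c $ A"]) (auto simp: supp_def)
qed

text \<open>The value at \<open>P\<close> does not matter, because the other lines still cover
  \<open>P\<close>.\<close>

lemma subtract_concurrent_line:
  fixes c :: "'a::{field, finite} ^ 'a point"
  assumes "(\<lambda>Q. c $ Q) constant_on (l - {P})" "P \<in> \<Union>L" "supp c \<subseteq> l \<union> \<Union>L"
  obtains k where "supp (c - k *s char_vec l) \<subseteq> \<Union>L"
proof -
  obtain k where "\<And>Q. Q \<in> l - {P} \<Longrightarrow> c $ Q = k"
    using assms(1) by (auto simp: constant_on_def)
  then show ?thesis
    using assms(2,3) by (intro that[of k]) (auto simp: supp_def)
qed

lemma span_insert_line:
  assumes "c - k *s char_vec l \<in> vec.span (char_vec ` L)"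
  shows "c \<in> vec.span (char_vec ` insert l L)"
  using assms by (auto simp: vec.span_breakdown_eq)

text \<open>The lines can be split off one after another, since the absence of concurrent triples
  passes to subsets of \<open>L\<close>.\<close>

lemma code_no_three_concurrent:
  fixes c :: "'a::{field, finite} ^ 'a point"
  assumes "c \<in> plane_code" "L \<subseteq> plane_lines" "supp c \<subseteq> \<Union>L"
    "\<And>l m m'. l \<in> L \<Longrightarrow> m \<in> L \<Longrightarrow> m' \<in> L \<Longrightarrow> l \<noteq> m \<Longrightarrow> l \<noteq> m' \<Longrightarrow> m \<noteq> m' \<Longrightarrow> l \<inter> m \<inter> m' = {}"
  shows "c \<in> vec.span (char_vec ` L)"
  using finite[of L] assms
proof (induction L arbitrary: c rule: finite_induct)
  case empty
  then have "c = 0"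
    by (auto simp: supp_def Finite_Cartesian_Product.vec_eq_iff)
  then show ?case
    by (simp add: vec.span_zero)
next
  case (insert l L)
  obtain k where k: "supp (c - k *s char_vec l) \<subseteq> \<Union>L"
  proof (rule subtract_line[of c l L])
    show "l \<inter> m \<inter> m' = {}" if "m \<in> L" "m' \<in> L" "m \<noteq> m'" for m m'
      using insert.prems(4)[of l m m'] insert.hyps that by blast
  qed (use insert.prems(1-3) in auto)
  have "c - k *s char_vec l \<in> vec.span (char_vec ` L)"
  proof (rule insert.IH)
    show "c - k *s char_vec l \<in> plane_code"
      using insert.prems(1,2) by (intro plane_code_diff_line) auto
    show "l \<inter> m \<inter> m' = {}" if "l \<in> L" "m \<in> L" "m' \<in> L" "l \<noteq> m" "l \<noteq> m'" "m \<noteq> m'" for l m m'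
      by (rule insert.prems(4)) (use that in auto)
  qed (use insert.prems(1-3) k in auto)
  then show ?case
    by (rule span_insert_line)
qed

lemma code_two_lines:
  fixes c :: "'a::{field, finite} ^ 'a point"
  assumes "c \<in> plane_code" "L \<subseteq> plane_lines" "supp c \<subseteq> \<Union>L" "card L \<le> 2"
  shows "c \<in> vec.span (char_vec ` L)"
proof (rule code_no_three_concurrent[OF assms(1-3)])
  fix l m m' assume "l \<in> L" "m \<in> L" "m' \<in> L" "l \<noteq> m" "l \<noteq> m'" "m \<noteq> m'"
  then have "card {l, m, m'} \<le> card L"
    by (intro card_mono) auto
  then show "l \<inter> m \<inter> m' = {}"
    using \<open>l \<noteq> m\<close> \<open>l \<noteq> m'\<close> \<open>m \<noteq> m'\<close> assms(4) by simp
qed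

text \<open>A line on which \<open>c\<close> is constant off \<open>P\<close> can be split off;
  \<open>2 \<le> card L\<close> ensures that another line still covers \<open>P\<close>. If there is
  no such line, \<open>c\<close> is odd by definition.\<close>

lemma concurrent_lines_dichotomy:
  fixes c :: "'a::{field, finite} ^ 'a point"
  assumes c: "c \<in> plane_code" and L: "L \<subseteq> plane_lines" "2 \<le> card L" and supp: "supp c \<subseteq> \<Union>L"
    and P: "\<And>l. l \<in> L \<Longrightarrow> P \<in> l"
  shows "odd_codeword_with P L c \<or> (\<exists>l\<in>L. \<exists>k. supp (c - k *s char_vec l) \<subseteq> \<Union>(L - {l}))"
proof (cases "\<exists>l\<in>L. (\<lambda>Q. c $ Q) constant_on (l - {P})")
  case True
  then obtain l where l: "l \<in> L" "(\<lambda>Q. c $ Q) constant_on (l - {P})"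
    by blast
  have "card (L - {l}) \<noteq> 0"
    using l(1) L(2) by simp
  then have "L - {l} \<noteq> {}"
    by (metis card.empty)
  then have "P \<in> \<Union>(L - {l})"
    using P by blast
  then obtain k where "supp (c - k *s char_vec l) \<subseteq> \<Union>(L - {l})"
    by (rule subtract_concurrent_line[OF l(2)]) (use supp in auto)
  then show ?thesis
    using l(1) by blast
next
  case False
  then show ?thesis
    using c L(1) supp P by (auto simp: odd_codeword_with_def)
qed

lemma code_three_lines:
  fixes c :: "'a::{field, finite} ^ 'a point"
  assumes c: "c \<in> plane_code" and L: "L \<subseteq> plane_lines" "card L = 3" and supp: "supp c \<subseteq> \<Union>L"
  shows "c \<in> vec.span (char_vec ` L) \<or> (\<exists>P. odd_codeword_with P L c)"
proof (cases "\<exists>P. \<forall>l\<in>L. P \<in> l")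
  case False
  have "c \<in> vec.span (char_vec ` L)"
  proof (rule code_no_three_concurrent[OF c L(1) supp])
    fix l m m' assume lm: "l \<in> L" "m \<in> L" "m' \<in> L" "l \<noteq> m" "l \<noteq> m'" "m \<noteq> m'"
    then have "{l, m, m'} = L"
      using L(2) by (intro card_subset_eq) auto
    then show "l \<inter> m \<inter> m' = {}"
      using False by blast
  qed
  then show ?thesis ..
next
  case True
  then obtain P where P: "\<And>l. l \<in> L \<Longrightarrow> P \<in> l"
    by blast
  have "c \<in> vec.span (char_vec ` L)" if l: "l \<in> L" "supp (c - k *s char_vec l) \<subseteq> \<Union>(L - {l})" for l k
  proof -
    have "c - k *s char_vec l \<in> vec.span (char_vec ` (L - {l}))"
    proof (rule code_two_lines)
      show "c - k *s char_vec l \<in> plane_code"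
        using c L(1) l(1) by (intro plane_code_diff_line) auto
    qed (use L l in auto)
    then have "c \<in> vec.span (char_vec ` insert l (L - {l}))"
      by (rule span_insert_line)
    then show ?thesis
      using l(1) by (simp add: insert_absorb)
  qed
  moreover have "odd_codeword_with P L c \<or> (\<exists>l\<in>L. \<exists>k. supp (c - k *s char_vec l) \<subseteq> \<Union>(L - {l}))"
    by (rule concurrent_lines_dichotomy[OF c L(1) _ supp P]) (simp add: L(2))
  ultimately show ?thesis
    by blast
qed

text \<open>Once one line is split off, the case of three lines applies. A line in no concurrent
  triple can always be split off; if every line is in one, all four are concurrent, and either a
  line can be split off or \<open>c\<close> is odd.\<close>

lemma code_four_lines:
  fixes c :: "'a::{field, finite} ^ 'a point"
  assumes c: "c \<in> plane_code" and L: "L \<subseteq> plane_lines" "card L = 4" and supp: "supp c \<subseteq> \<Union>L"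
  shows "c \<in> vec.span (char_vec ` L)
    \<or> (\<exists>P d. \<exists>l\<in>L. odd_codeword_with P (L - {l}) d \<and> c \<in> vec.span {d, char_vec l})
    \<or> (\<exists>P. odd_codeword_with P L c)"
proof -
  have reduce: ?thesis if l: "l \<in> L" "supp (c - k *s char_vec l) \<subseteq> \<Union>(L - {l})" for l k
  proof -
    let ?d = "c - k *s char_vec l"
    have "?d \<in> plane_code"
      using c L(1) l(1) by (intro plane_code_diff_line) auto
    then have "?d \<in> vec.span (char_vec ` (L - {l})) \<or> (\<exists>P. odd_codeword_with P (L - {l}) ?d)"
      by (rule code_three_lines) (use L l in auto)
    then show ?thesis
    proof
      assume "?d \<in> vec.span (char_vec ` (L - {l}))"
      then have "c \<in> vec.span (char_vec ` insert l (L - {l}))"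
        by (rule span_insert_line)
      then show ?thesis
        using l(1) by (simp add: insert_absorb)
    next
      assume "\<exists>P. odd_codeword_with P (L - {l}) ?d"
      moreover have "?d + k *s char_vec l \<in> vec.span {?d, char_vec l}"
        by (intro vec.span_add vec.span_scale vec.span_base) auto
      then have "c \<in> vec.span {?d, char_vec l}"
        by simp
      ultimately show ?thesis
        using l(1) by blast
    qed
  qed
  show ?thesis
  proof (cases "\<exists>l\<in>L. \<forall>m\<in>L - {l}. \<forall>m'\<in>L - {l}. m \<noteq> m' \<longrightarrow> l \<inter> m \<inter> m' = {}")
    case True
    then obtain l where l: "l \<in> L" "\<forall>m\<in>L - {l}. \<forall>m'\<in>L - {l}. m \<noteq> m' \<longrightarrow> l \<inter> m \<inter> m' = {}"
      by blast
    have "l \<in> plane_lines" "L - {l} \<subseteq> plane_lines" "supp c \<subseteq> l \<union> \<Union>(L - {l})"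
      using L(1) l(1) supp by auto
    then obtain k where "supp (c - k *s char_vec l) \<subseteq> \<Union>(L - {l})"
      by (rule subtract_line[OF c _ _ _ l(2)[rule_format]])
    then show ?thesis
      by (rule reduce[OF l(1)])
  next
    case False
    then have triple: "\<exists>m\<in>L - {l}. \<exists>m'\<in>L - {l}. m \<noteq> m' \<and> l \<inter> m \<inter> m' \<noteq> {}" if "l \<in> L" for l
      using that by meson
    have "L \<noteq> {}"
      using L(2) by auto
    then obtain l1 where l1: "l1 \<in> L"
      by blast
    obtain l2 l3 where l23: "l2 \<in> L" "l3 \<in> L" "l2 \<noteq> l1" "l3 \<noteq> l1" "l2 \<noteq> l3"
        and "l1 \<inter> l2 \<inter> l3 \<noteq> {}"
      using triple[OF l1] by auto
    then obtain P where P: "P \<in> l1" "P \<in> l2" "P \<in> l3"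
      by auto
    have "card (L - {l1, l2, l3}) = 1"
      using l1 l23 L(2) by (simp add: card_Diff_subset)
    then obtain l4 where l4: "L - {l1, l2, l3} = {l4}"
      by (rule card_1_singletonE)
    have "l4 \<in> L - {l1, l2, l3}"
      unfolding l4 by simp
    then have "l4 \<in> L"
      by simp
    have L_sub: "L - {l4} \<subseteq> {l1, l2, l3}"
      unfolding l4[symmetric] by blast
    obtain m m' where mm: "m \<in> L - {l4}" "m' \<in> L - {l4}" "m \<noteq> m'" "l4 \<inter> m \<inter> m' \<noteq> {}"
      using triple[OF \<open>l4 \<in> L\<close>] by (elim bexE conjE)
    from mm(4) obtain Q where Q: "Q \<in> l4" "Q \<in> m" "Q \<in> m'"
      by auto
    have P': "P \<in> l" if "l \<in> L - {l4}" for l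
      using subsetD[OF L_sub that] P by auto
    have "m \<in> plane_lines" "m' \<in> plane_lines" "P \<in> m" "P \<in> m'"
      using mm(1,2) L(1) P' by auto
    \<comment> \<open>The lines \<open>m\<close> and \<open>m'\<close> are two of \<open>l1\<close>,
      \<open>l2\<close>, \<open>l3\<close>, so \<open>P\<close> is their only common point and
      \<open>l4\<close> passes through it too.\<close>
    then have "P = Q"
      using plane_lines_eqI[of m m' P Q] mm(3) Q by blast
    then have "P \<in> l" if "l \<in> L" for l
      using that P' Q(1) by (cases "l = l4") auto
    then have "odd_codeword_with P L c \<or> (\<exists>l\<in>L. \<exists>k. supp (c - k *s char_vec l) \<subseteq> \<Union>(L - {l}))"
      by (intro concurrent_lines_dichotomy[OF c L(1) _ supp]) (simp_all add: L(2))
    then show ?thesis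
      using reduce by blast
  qed
qed

theorem theorem1p18:
  fixes p :: nat and c :: "'a::{field, finite} ^ 'a point"
  assumes "prime p" and "p \<ge> 37" and "CARD('a) = p"
    and "c \<in> plane_code"
    and "p \<le> 47 \<Longrightarrow> wt c \<le> 4 * p + 3"
    and "p \<ge> 53 \<Longrightarrow> wt c \<le> 5 * p - 36"
  shows "(\<exists>L \<subseteq> plane_lines. card L \<le> 4 \<and> c \<in> vec.span (char_vec ` L))
    \<or> (\<exists>P L d l. card L = 3 \<and> odd_codeword_with P L d \<and> l \<in> plane_lines - L \<and>
          c \<in> vec.span {d, char_vec l})
    \<or> odd_codeword 4 c"
proof -
  \<comment> \<open>No prime lies strictly between 47 and 53, so one of the two weight hypotheses
    always applies. For \<open>p \<ge> 37\<close> both give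
    \<open>wt c + 26 \<le> 5 * p\<close>.\<close>
  have "\<not> prime (48::nat)" "\<not> prime (49::nat)" "\<not> prime (50::nat)" "\<not> prime (51::nat)" "\<not> prime (52::nat)"
    by simp_all
  then have "p \<notin> {48, 49, 50, 51, 52}"
    using assms(1) by auto
  then have "p \<le> 47 \<or> p \<ge> 53"
    by auto
  then have "wt c + 26 \<le> 5 * CARD('a)" "17 \<le> CARD('a)"
    using assms(2,3,5,6) by auto
  then obtain L where L: "L \<subseteq> plane_lines" "card L = 4" "supp c \<subseteq> \<Union>L"
    by (rule supp_covered_by_four_lines[OF assms(4)])
  from code_four_lines[OF assms(4) L] show ?thesis
  proof (elim disjE exE bexE conjE)
    assume "c \<in> vec.span (char_vec ` L)"
    then show ?thesis
      using L by (intro disjI1) auto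
  next
    fix P d l assume "l \<in> L" "odd_codeword_with P (L - {l}) d" "c \<in> vec.span {d, char_vec l}"
    moreover from this have "card (L - {l}) = 3" "l \<in> plane_lines - (L - {l})"
      using L by auto
    ultimately show ?thesis
      by blast
  next
    fix P assume "odd_codeword_with P L c"
    then show ?thesis
      using L(2) unfolding odd_codeword_def by blast
  qed
qed

end
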